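(* Let $X$ be a CAT(0) cube complex and let $X[v,w]$ be an interval of $X$ of dimension $n$. Then $X[v,w]$ is isomorphic (as a cube complex) to a subcomplex of the integer lattice cubing of $\mathbb{R}^n$.
   Context: For vertices $v,w$ of a CAT(0) cube complex $X$, the interval $X[v,w]$ is the subcomplex of $X$ consisting of all cubes all of whose vertices lie on at least one edge geodesic (shortest path along edges) between $v$ and $w$. The dimension of an interval is the dimension of the largest cube it contains. The integer lattice cubing of $\mathbb{R}^n$ is the cube complex whose vertices are the points of $\mathbb{Z}^n$ and whose cubes are the unit cubes with vertices in $\mathbb{Z}^n$. *)

theory Defs
  imports Main
begin

(* A cube complex whose cubes are determined by their vertex sets is represented by
   its set C of cubes, each cube being the (finite, nonempty) set of its vertices.
   Edges (1-cubes) are the 2-element cubes. *)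

definition is_edge :: "'v set set \<Rightarrow> 'v \<Rightarrow> 'v \<Rightarrow> bool" where
  "is_edge C x y \<longleftrightarrow> x \<noteq> y \<and> {x, y} \<in> C"

(* the face of a cube chart f : Pow I -> vertices, with free coordinates J and
   coordinates A set to 1 (the others to 0) *)
definition cube_face :: "(nat set \<Rightarrow> 'v) \<Rightarrow> nat set \<Rightarrow> nat set \<Rightarrow> 'v set" where
  "cube_face f J A = (\<lambda>S. f (A \<union> S)) ` Pow J"

(* f identifies the standard cube {0,1}^I (vertices = subsets of I) with the cube Q *)
definition cube_chart :: "'v set set \<Rightarrow> 'v set \<Rightarrow> nat set \<Rightarrow> (nat set \<Rightarrow> 'v) \<Rightarrow> bool" where
  "cube_chart C Q I f \<longleftrightarrow> finite I \<and> bij_betw f (Pow I) Q \<and>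
     (\<forall>S\<in>Pow I. \<forall>T\<in>Pow I. is_edge C (f S) (f T) \<longleftrightarrow> card ((S - T) \<union> (T - S)) = 1) \<and>
     (\<forall>J A. J \<subseteq> I \<and> A \<subseteq> I - J \<longrightarrow> cube_face f J A \<in> C) \<and>
     (\<forall>P\<in>C. P \<subseteq> Q \<longrightarrow> (\<exists>J A. J \<subseteq> I \<and> A \<subseteq> I - J \<and> P = cube_face f J A))"

definition cube_complex :: "'v set set \<Rightarrow> bool" where
  "cube_complex C \<longleftrightarrow> {} \<notin> C \<and> (\<forall>Q\<in>C. \<exists>I f. cube_chart C Q I f) \<and>
     (\<forall>Q\<in>C. \<forall>P\<in>C. Q \<inter> P \<noteq> {} \<longrightarrow> Q \<inter> P \<in> C)"

definition walk :: "'v set set \<Rightarrow> 'v list \<Rightarrow> bool" where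
  "walk C p \<longleftrightarrow> p \<noteq> [] \<and> set p \<subseteq> \<Union>C \<and>
     (\<forall>i. Suc i < length p \<longrightarrow> is_edge C (p ! i) (p ! Suc i))"

inductive htpy_step :: "'v set set \<Rightarrow> 'v list \<Rightarrow> 'v list \<Rightarrow> bool" for C where
  backtrack: "is_edge C x y \<Longrightarrow> htpy_step C (p @ [x] @ q) (p @ [x, y, x] @ q)"
| square: "{a, b, c, d} \<in> C \<Longrightarrow> card {a, b, c, d} = 4 \<Longrightarrow> is_edge C a b \<Longrightarrow> is_edge C b c \<Longrightarrow>
           is_edge C c d \<Longrightarrow> is_edge C d a \<Longrightarrow>
           htpy_step C (p @ [a, b, c] @ q) (p @ [a, d, c] @ q)"

definition homotopic_paths :: "'v set set \<Rightarrow> 'v list \<Rightarrow> 'v list \<Rightarrow> bool" where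
  "homotopic_paths C = (\<lambda>p q. htpy_step C p q \<or> htpy_step C q p)\<^sup>*\<^sup>*"

definition simply_connected_cc :: "'v set set \<Rightarrow> bool" where
  "simply_connected_cc C \<longleftrightarrow> \<Union>C \<noteq> {} \<and>
     (\<forall>x\<in>\<Union>C. \<forall>y\<in>\<Union>C. \<exists>p. walk C p \<and> hd p = x \<and> last p = y) \<and>
     (\<forall>p. walk C p \<and> hd p = last p \<longrightarrow> homotopic_paths C p [hd p])"

(* Gromov's link condition: links of vertices are flag simplicial complexes.
   (Simpliciality of links is automatic for cube complexes as represented here.)
   Flag: every finite set N of link vertices (neighbours of v) which are pairwise
   joined in the link (the corresponding edges span a square) spans a simplex
   (the edges span a cube of dimension card N). *)
definition flag_links :: "'v set set \<Rightarrow> bool" where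
  "flag_links C \<longleftrightarrow> (\<forall>v N. v \<in> \<Union>C \<and> finite N \<and> (\<forall>x\<in>N. is_edge C v x) \<and>
      (\<forall>x\<in>N. \<forall>y\<in>N. x \<noteq> y \<longrightarrow> (\<exists>Q\<in>C. card Q = 4 \<and> {v, x, y} \<subseteq> Q))
      \<longrightarrow> (\<exists>Q\<in>C. card Q = 2 ^ card N \<and> insert v N \<subseteq> Q))"

definition CAT0_cube_complex :: "'v set set \<Rightarrow> bool" where
  "CAT0_cube_complex C \<longleftrightarrow> cube_complex C \<and> simply_connected_cc C \<and> flag_links C"

definition edge_geodesic :: "'v set set \<Rightarrow> 'v \<Rightarrow> 'v \<Rightarrow> 'v list \<Rightarrow> bool" where
  "edge_geodesic C v w p \<longleftrightarrow> walk C p \<and> hd p = v \<and> last p = w \<and>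
     (\<forall>q. walk C q \<and> hd q = v \<and> last q = w \<longrightarrow> length p \<le> length q)"

definition interval :: "'v set set \<Rightarrow> 'v \<Rightarrow> 'v \<Rightarrow> 'v set set" where
  "interval C v w = {Q \<in> C. \<forall>u\<in>Q. \<exists>p. edge_geodesic C v w p \<and> u \<in> set p}"

(* a cube with 2^n vertices has dimension n *)
definition complex_dim :: "'v set set \<Rightarrow> nat \<Rightarrow> bool" where
  "complex_dim K n \<longleftrightarrow> (\<exists>Q\<in>K. card Q = 2 ^ n) \<and> (\<forall>Q\<in>K. card Q \<le> 2 ^ n)"

(* integer lattice cubing of R^n: points of Z^n are functions nat => int vanishing
   outside {0..<n} *)
definition lattice_cube :: "nat \<Rightarrow> (nat \<Rightarrow> int) set \<Rightarrow> bool" where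
  "lattice_cube n Q \<longleftrightarrow> (\<exists>x J. (\<forall>i\<ge>n. x i = 0) \<and> J \<subseteq> {..<n} \<and>
      Q = {(\<lambda>i. x i + (if i \<in> S then 1 else 0)) | S. S \<subseteq> J})"

definition lattice_subcomplex :: "nat \<Rightarrow> (nat \<Rightarrow> int) set set \<Rightarrow> bool" where
  "lattice_subcomplex n L \<longleftrightarrow> (\<forall>Q\<in>L. lattice_cube n Q) \<and>
     (\<forall>Q\<in>L. \<forall>P. lattice_cube n P \<and> P \<subseteq> Q \<longrightarrow> P \<in> L)"

definition cc_isomorphic :: "'a set set \<Rightarrow> 'b set set \<Rightarrow> bool" where
  "cc_isomorphic K L \<longleftrightarrow> (\<exists>\<phi>. bij_betw \<phi> (\<Union>K) (\<Union>L) \<and>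
     (\<forall>Q. Q \<subseteq> \<Union>K \<longrightarrow> (Q \<in> K \<longleftrightarrow> \<phi> ` Q \<in> L)))"

end

theory Submission
  imports Defs
begin

text \<open>Edge paths modulo exchange of two sides of a square behave like words in a right-angled
Coxeter group: the flag condition gives a Tits-style normal form, so in a simply connected complex
any two backtrack-free paths with the same ends differ by square exchanges only. This yields the
quadrangle condition: two neighbours of \<open>y\<close> that are closer to \<open>z\<close> span with \<open>y\<close> a square
whose fourth vertex is closer still. Hyperplanes are then represented by the halfspaces
\<open>halfspace a b\<close> of vertices closer to \<open>a\<close> than to \<open>b\<close>, which do not change when the edge \<open>ab\<close> is
moved across a square. A vertex \<open>x\<close> of the interval is determined by the halfspaces containing \<open>v\<close>
but not \<open>w\<close> that miss \<open>x\<close>. Pairwise incomparable such halfspaces are dual to a cube of the interval,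
so there are at most \<open>n\<close> of them, and Dilworth's theorem splits the halfspaces into \<open>n\<close> chains;
the \<open>j\<close>-th coordinate of \<open>x\<close> counts the halfspaces of the \<open>j\<close>-th chain that miss \<open>x\<close>.\<close>

section \<open>Squares and centred charts\<close>

text \<open>Simple connectedness is known only through \<open>htpy_step\<close>, whose homotopies
  may lengthen a path by backtracks without bound, so paths of equal length cannot be compared by
  following a homotopy between them. The normal form removes this obstacle: it is defined for every
  path, and each single move preserves its class. After that the geometry rests on the quadrangle
  condition and on the parity of closed paths. Separators are ordered by inclusion. In a chain of
  them, those missing a vertex \<open>x\<close> form an initial segment, so their number alone
  recovers them and counting per chain loses nothing. The directions of one cube of the interval
  have pairwise incomparable halfspaces, hence lie in different chains, so the cube is mapped to a
  unit lattice cube and not folded. The dimension enters through the converse: an antichain must be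
  realised by an actual cube. Incomparability is used there at one place, to show that a vertex
  which cannot be moved farther from \<open>v\<close> inside the interval without leaving a member
  of the antichain already touches all of their hyperplanes.\<close>

definition sq :: "'v set set \<Rightarrow> 'v \<Rightarrow> 'v \<Rightarrow> 'v \<Rightarrow> 'v \<Rightarrow> bool" where
  "sq C a b c d \<longleftrightarrow> {a, b, c, d} \<in> C \<and> card {a, b, c, d} = 4 \<and>
     is_edge C a b \<and> is_edge C b c \<and> is_edge C c d \<and> is_edge C d a"

text \<open>A cube chart recentred at a chosen vertex: the empty set is sent to \<open>u\<close>, so
  the singletons label the edges of \<open>Q\<close> at \<open>u\<close>.\<close>

definition chart_at :: "'v set set \<Rightarrow> 'v set \<Rightarrow> nat set \<Rightarrow> (nat set \<Rightarrow> 'v) \<Rightarrow> 'v \<Rightarrow> bool" where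
  "chart_at C Q I g u \<longleftrightarrow> finite I \<and> bij_betw g (Pow I) Q \<and> g {} = u \<and>
     (\<forall>S\<in>Pow I. \<forall>T\<in>Pow I. is_edge C (g S) (g T) \<longleftrightarrow> card ((S - T) \<union> (T - S)) = 1) \<and>
     (\<forall>J A. J \<subseteq> I \<and> A \<subseteq> I - J \<longrightarrow> cube_face g J A \<in> C)"

lemma is_edge_sym: "is_edge C x y \<Longrightarrow> is_edge C y x"
  by (auto simp: is_edge_def insert_commute)

lemma is_edge_vertices: "is_edge C x y \<Longrightarrow> x \<in> \<Union>C \<and> y \<in> \<Union>C"
  by (auto simp: is_edge_def)

lemma sq_rotate: "sq C a b c d \<Longrightarrow> sq C b c d a"
  by (auto simp: sq_def insert_commute)

lemma sq_flip: "sq C a b c d \<Longrightarrow> sq C a d c b"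
  by (auto simp: sq_def insert_commute intro: is_edge_sym)

lemma sq_rotate_back: "sq C a b c d \<Longrightarrow> sq C d a b c"
  by (rule sq_rotate[OF sq_rotate[OF sq_rotate]])

lemma sq_swap: "sq C a b c d \<Longrightarrow> sq C b a d c"
  by (rule sq_rotate_back[OF sq_flip])

lemma sq_edges:
  assumes "sq C a b c d"
  shows "is_edge C a b" "is_edge C b c" "is_edge C c d" "is_edge C d a"
  using assms by (auto simp: sq_def)

lemma sq_distinct:
  assumes "sq C a b c d"
  shows "a \<noteq> b" "a \<noteq> c" "a \<noteq> d" "b \<noteq> c" "b \<noteq> d" "c \<noteq> d"
proof -
  have "card {a, b, c, d} = 4" using assms by (simp add: sq_def)
  then show "a \<noteq> b" "a \<noteq> c" "a \<noteq> d" "b \<noteq> c" "b \<noteq> d" "c \<noteq> d"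
    by (auto simp: card_insert_if split: if_splits)
qed

text \<open>Symmetric difference with \<open>A\<close> is a translation of the cube: an involution
  that keeps Hamming distances and carries faces to faces.\<close>

lemma cube_chart_rebase:
  assumes f: "cube_chart C Q I f" and A: "A \<subseteq> I"
  shows "chart_at C Q I (\<lambda>S. f ((A - S) \<union> (S - A))) (f A)"
  unfolding chart_at_def
proof (intro conjI allI impI ballI)
  let ?s = "\<lambda>S. (A - S) \<union> (S - A)"
  show "finite I" using f by (simp add: cube_chart_def)
  have "bij_betw ?s (Pow I) (Pow I)"
    by (rule bij_betw_byWitness[where f' = ?s]) (use A in auto)
  then show "bij_betw (\<lambda>S. f (?s S)) (Pow I) Q"
    using f bij_betw_trans[of ?s "Pow I" "Pow I" f Q] by (simp add: cube_chart_def o_def)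
  show "f (?s {}) = f A" by simp
  show "is_edge C (f (?s S)) (f (?s T)) \<longleftrightarrow> card ((S - T) \<union> (T - S)) = 1"
    if "S \<in> Pow I" "T \<in> Pow I" for S T
  proof -
    have "(?s S - ?s T) \<union> (?s T - ?s S) = (S - T) \<union> (T - S)" by blast
    moreover have "?s S \<in> Pow I" "?s T \<in> Pow I" using that A by auto
    ultimately show ?thesis using f unfolding cube_chart_def by metis
  qed
  show "cube_face (\<lambda>S. f (?s S)) J B \<in> C" if JB: "J \<subseteq> I \<and> B \<subseteq> I - J" for J B
  proof -
    \<comment> \<open>The translate splits into the fixed coordinates \<open>?B\<close> and the free
      ones in \<open>J\<close>; on the latter it is an involution of \<open>Pow J\<close>.\<close>
    let ?B = "?s B - J"
    have "bij_betw (\<lambda>S. ?s (B \<union> S) \<inter> J) (Pow J) (Pow J)"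
      by (rule bij_betw_byWitness[where f' = "\<lambda>S. ?s (B \<union> S) \<inter> J"]) (use JB in auto)
    then have im: "(\<lambda>S. ?s (B \<union> S) \<inter> J) ` Pow J = Pow J" by (simp add: bij_betw_def)
    have "cube_face (\<lambda>S. f (?s S)) J B = (\<lambda>S. f (?B \<union> (?s (B \<union> S) \<inter> J))) ` Pow J"
      unfolding cube_face_def
    proof (rule image_cong[OF refl])
      fix S assume "S \<in> Pow J"
      then have "?s (B \<union> S) = ?B \<union> (?s (B \<union> S) \<inter> J)" using JB by auto
      then show "f (?s (B \<union> S)) = f (?B \<union> (?s (B \<union> S) \<inter> J))" by simp
    qed
    also have "\<dots> = cube_face f J ?B"
      unfolding cube_face_def by (subst (2) im[symmetric]) (simp add: image_image)
    finally have "cube_face (\<lambda>S. f (?s S)) J B = cube_face f J ?B" .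
    moreover have "J \<subseteq> I \<and> ?B \<subseteq> I - J" using JB A by auto
    then have "cube_face f J ?B \<in> C" using f by (simp only: cube_chart_def)
    ultimately show ?thesis by simp
  qed
qed

lemma chart_at_edge:
  assumes g: "chart_at C Q I g u" and S: "S \<subseteq> I" and i: "i \<in> I - S"
  shows "is_edge C (g S) (g (insert i S))"
proof -
  have "(S - insert i S) \<union> (insert i S - S) = {i}" using i by auto
  then have "card ((S - insert i S) \<union> (insert i S - S)) = 1" by simp
  then show ?thesis using g S i unfolding chart_at_def by blast
qed

lemma chart_at_sq:
  assumes g: "chart_at C Q I g u" and S: "S \<subseteq> I" and i: "i \<in> I - S" and j: "j \<in> I - S" and "i \<noteq> j"
  shows "sq C (g S) (g (insert i S)) (g (insert i (insert j S))) (g (insert j S))"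
proof -
  have Pow: "Pow {i, j} = {{}, {i}, {j}, {i, j}}" by auto
  have "cube_face g {i, j} S = {g S, g (insert i S), g (insert i (insert j S)), g (insert j S)}"
    unfolding cube_face_def Pow by (auto simp: insert_commute)
  moreover have "{i, j} \<subseteq> I \<and> S \<subseteq> I - {i, j}" using S i j by auto
  then have "cube_face g {i, j} S \<in> C" using g by (simp only: chart_at_def)
  moreover have "inj_on g (Pow I)" using g by (simp add: chart_at_def bij_betw_def)
  then have inj: "g A = g B \<longleftrightarrow> A = B" if "A \<subseteq> I" "B \<subseteq> I" for A B
    using that by (auto simp: inj_on_def)
  have "card {g S, g (insert i S), g (insert i (insert j S)), g (insert j S)} = 4"
  proof -
    have "S \<noteq> insert i S" "S \<noteq> insert i (insert j S)" "S \<noteq> insert j S"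
      "insert i S \<noteq> insert i (insert j S)" "insert i S \<noteq> insert j S"
      "insert i (insert j S) \<noteq> insert j S"
      using i j \<open>i \<noteq> j\<close> by auto
    then show ?thesis using S i j by (simp add: inj)
  qed
  moreover have "is_edge C (g S) (g (insert i S))" "is_edge C (g (insert j S)) (g S)"
    "is_edge C (g (insert i S)) (g (insert i (insert j S)))"
    "is_edge C (g (insert i (insert j S))) (g (insert j S))"
    using chart_at_edge[OF g, of S i] chart_at_edge[OF g, of S j] chart_at_edge[OF g, of "insert i S" j]
      chart_at_edge[OF g, of "insert j S" i] S i j \<open>i \<noteq> j\<close>
    by (auto simp: insert_commute intro: is_edge_sym)
  ultimately show ?thesis by (simp add: sq_def)
qed

lemma chart_at_nbr:
  assumes g: "chart_at C Q I g u" and "is_edge C u x" and "x \<in> Q"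
  shows "\<exists>i\<in>I. x = g {i}"
proof -
  have "Q = g ` Pow I" using g by (simp add: chart_at_def bij_betw_def)
  then obtain T where T: "T \<subseteq> I" "x = g T" using assms(3) by auto
  moreover have "g {} = u" using g by (simp add: chart_at_def)
  ultimately have "is_edge C (g {}) (g T)" using assms(2) by simp
  then have "card (({} - T) \<union> (T - {})) = 1" using g T(1) unfolding chart_at_def by blast
  then obtain i where "T = {i}" by (auto simp: card_1_singleton_iff)
  then show ?thesis using T by auto
qed

lemma chart_at_card: "chart_at C Q I g u \<Longrightarrow> card Q = 2 ^ card I"
  by (metis bij_betw_same_card card_Pow chart_at_def)

section \<open>Paths modulo square exchange\<close>

text \<open>The square move of \<open>htpy_step\<close>, generated from the head of the list so that
  the first steps of a path can be analysed by cases.\<close>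

inductive square_swap :: "'v set set \<Rightarrow> 'v list \<Rightarrow> 'v list \<Rightarrow> bool" for C where
  here: "sq C a b c d \<Longrightarrow> square_swap C (a # b # c # r) (a # d # c # r)"
| there: "square_swap C p q \<Longrightarrow> square_swap C (x # p) (x # q)"

definition eqv :: "'v set set \<Rightarrow> 'v list \<Rightarrow> 'v list \<Rightarrow> bool" where
  "eqv C = (square_swap C)\<^sup>*\<^sup>*"

inductive has_backtrack :: "'v list \<Rightarrow> bool" where
  bt_here: "has_backtrack (a # b # a # r)"
| bt_there: "has_backtrack p \<Longrightarrow> has_backtrack (x # p)"

text \<open>The analogue of a reduced word: no sequence of commutations (square exchanges) exposes a
  cancellation (a backtrack).\<close>

definition reduced :: "'v set set \<Rightarrow> 'v list \<Rightarrow> bool" where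
  "reduced C p \<longleftrightarrow> \<not> (\<exists>q. eqv C p q \<and> has_backtrack q)"

lemma square_swap_sym: "square_swap C p q \<Longrightarrow> square_swap C q p"
  by (induction rule: square_swap.induct) (auto intro: square_swap.intros sq_flip)

lemma square_swap_hd_length: "square_swap C p q \<Longrightarrow> hd p = hd q \<and> last p = last q \<and> length p = length q"
proof (induction rule: square_swap.induct)
  case (there p q x)
  then show ?case by (cases p; cases q) auto
qed auto

lemma eqv_refl [simp]: "eqv C p p"
  by (simp add: eqv_def)

lemma eqv_trans [trans]: "eqv C p q \<Longrightarrow> eqv C q r \<Longrightarrow> eqv C p r"
  by (simp add: eqv_def)

lemma eqv_sym: "eqv C p q \<Longrightarrow> eqv C q p"
  unfolding eqv_def by (metis square_swap_sym sympI sympD symp_rtranclp)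

lemma square_swap_eqv: "square_swap C p q \<Longrightarrow> eqv C p q"
  by (simp add: eqv_def)

lemma eqv_Cons: "eqv C p q \<Longrightarrow> eqv C (x # p) (x # q)"
  unfolding eqv_def
  by (induction rule: rtranclp_induct) (auto intro: square_swap.there rtranclp.rtrancl_into_rtrancl)

lemma eqv_sq: "sq C a b c d \<Longrightarrow> eqv C (a # b # c # r) (a # d # c # r)"
  by (intro square_swap_eqv square_swap.here)

lemma eqv_hd_length: "eqv C p q \<Longrightarrow> hd p = hd q \<and> last p = last q \<and> length p = length q"
  unfolding eqv_def by (induction rule: rtranclp_induct) (auto dest: square_swap_hd_length)

lemma eqv_ConsD: "eqv C (x # p) q \<Longrightarrow> \<exists>q'. q = x # q'"
  by (cases q) (auto dest: eqv_hd_length)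

lemma reduced_eqv: "reduced C p \<Longrightarrow> eqv C p q \<Longrightarrow> reduced C q"
  unfolding reduced_def by (meson eqv_trans)

lemma reduced_ConsD: "reduced C (x # p) \<Longrightarrow> reduced C p"
  unfolding reduced_def by (meson eqv_Cons bt_there)

lemma not_red_bt: "\<not> reduced C (a # b # a # r)"
  unfolding reduced_def by (meson bt_here eqv_refl)

section \<open>Dilworth's theorem\<close>

definition antichain :: "'a::order set \<Rightarrow> bool" where
  "antichain A \<longleftrightarrow> (\<forall>x\<in>A. \<forall>y\<in>A. x \<le> y \<longrightarrow> x = y)"

definition chain_cover :: "('a::order \<Rightarrow> nat) \<Rightarrow> 'a set \<Rightarrow> nat \<Rightarrow> bool" where
  "chain_cover c P k \<longleftrightarrow> (\<forall>x\<in>P. c x < k) \<and> (\<forall>x\<in>P. \<forall>y\<in>P. c x = c y \<longrightarrow> x \<le> y \<or> y \<le> x)"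

lemma chain_cover_antichain_inj:
  "chain_cover c P k \<Longrightarrow> A \<subseteq> P \<Longrightarrow> antichain A \<Longrightarrow> inj_on c A"
  unfolding chain_cover_def antichain_def inj_on_def by (metis subsetD)

lemma chain_cover_add:
  assumes c: "chain_cover c (P - K) k" and K: "\<And>x y. x \<in> K \<Longrightarrow> y \<in> K \<Longrightarrow> x \<le> y \<or> y \<le> x"
  shows "chain_cover (\<lambda>x. if x \<in> K then k else c x) P (Suc k)"
  using assms unfolding chain_cover_def by (auto simp: less_Suc_eq)

text \<open>Galvin's proof: remove a maximal element \<open>a\<close> and cover the rest optimally by chains. The topmost
elements \<open>x i\<close> of the chains that lie on a maximum antichain form an antichain themselves; either
\<open>a\<close> extends it, or some \<open>x i \<le> a\<close> and the part of the \<open>i\<close>-th chain below \<open>x i\<close> together with \<open>a\<close> is a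
chain meeting all maximum antichains.\<close>

lemma dilworth:
  fixes P :: "'a::order set"
  assumes "finite P" "\<And>A. A \<subseteq> P \<Longrightarrow> antichain A \<Longrightarrow> card A \<le> n"
  shows "\<exists>c. chain_cover c P n"
  using assms
proof (induction "card P" arbitrary: P n rule: less_induct)
  case less
  show ?case
  proof (cases "P = {}")
    case True
    then show ?thesis by (auto simp: chain_cover_def)
  next
    case False
    then obtain a where a: "a \<in> P" "\<And>x. x \<in> P \<Longrightarrow> a \<le> x \<Longrightarrow> x = a"
      using finite_has_maximal[OF less(2)] by metis
    define P' where "P' = P - {a}"
    have P': "finite P'" "P' \<subseteq> P" "card P' < card P"
      using less(2) card_Diff1_less[OF less(2) a(1)] by (auto simp: P'_def)
    let ?S = "{A. A \<subseteq> P' \<and> antichain A}"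
    have "finite ?S" using P'(1) by (auto intro: finite_subset[of _ "Pow P'"])
    then have fin: "finite (card ` ?S)" by (rule finite_imageI)
    have "{} \<in> ?S" by (simp add: antichain_def)
    then have "Max (card ` ?S) \<in> card ` ?S" using Max_in[OF fin] by blast
    then obtain A0 where A0: "A0 \<in> ?S" "\<And>A. A \<in> ?S \<Longrightarrow> card A \<le> card A0"
      using Max_ge[OF fin] by (metis (no_types, lifting) imageE image_eqI)
    \<comment> \<open>The induction hypothesis is used with the exact maximum \<open>k\<close> for
      \<open>P'\<close>, not with \<open>n\<close>; then every antichain of size \<open>k\<close>
      meets each of the \<open>k\<close> chains.\<close>
    define k where "k = card A0"
    obtain c where c: "chain_cover c P' k"
      using less(1)[OF P'(3) P'(1), of k] A0(2) unfolding k_def by blast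
    have hit: "c ` A = {..<k}" if "A \<subseteq> P'" "antichain A" "card A = k" for A
    proof (rule card_subset_eq)
      show "c ` A \<subseteq> {..<k}" using c that by (auto simp: chain_cover_def)
      show "card (c ` A) = card {..<k}"
        using card_image[OF chain_cover_antichain_inj[OF c that(1,2)]] that(3) by simp
    qed simp
    define M where "M i = {x \<in> P'. c x = i \<and> (\<exists>A. A \<subseteq> P' \<and> antichain A \<and> card A = k \<and> x \<in> A)}" for i
    have MI: "y \<in> M (c y)" if "A \<subseteq> P'" "antichain A" "card A = k" "y \<in> A" for A y
      using that by (auto simp: M_def)
    have ex: "\<exists>x\<in>M i. \<forall>y\<in>M i. y \<le> x" if "i < k" for i
    proof -
      have A0': "A0 \<subseteq> P'" "antichain A0" "card A0 = k" using A0(1) by (auto simp: k_def)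
      have "i \<in> c ` A0" using hit[OF A0'] that by simp
      then have "M i \<noteq> {}" using MI[OF A0'] by auto
      moreover have "finite (M i)" using P'(1) by (simp add: M_def)
      ultimately obtain x where x: "x \<in> M i" "\<forall>y\<in>M i. x \<le> y \<longrightarrow> x = y"
        using finite_has_maximal[of "M i"] by auto
      have "y \<le> x" if "y \<in> M i" for y
        using c x that unfolding chain_cover_def M_def by (metis (mono_tags, lifting) mem_Collect_eq order_refl)
      then show ?thesis using x(1) by blast
    qed
    then have "\<forall>i\<in>{..<k}. \<exists>x. x \<in> M i \<and> (\<forall>y\<in>M i. y \<le> x)" by auto
    from bchoice[OF this] obtain x where
      xM: "\<And>i. i < k \<Longrightarrow> x i \<in> M i" and xmax: "\<And>i y. i < k \<Longrightarrow> y \<in> M i \<Longrightarrow> y \<le> x i"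
      by auto
    \<comment> \<open>A maximum antichain through \<open>x j\<close> meets chain \<open>i\<close> in
      some \<open>y\<close> with \<open>y \<le> x i \<le> x j\<close>, and being an antichain it
      gives \<open>y = x j\<close>.\<close>
    have xx: "i = j" if ij: "i < k" "j < k" "x i \<le> x j" for i j
    proof -
      obtain B where B: "B \<subseteq> P'" "antichain B" "card B = k" "x j \<in> B" using xM[OF ij(2)] by (auto simp: M_def)
      then obtain y where y: "y \<in> B" "c y = i" using hit[OF B(1-3)] ij(1) by (metis imageE lessThan_iff)
      then have "y \<le> x i" using xmax[OF ij(1)] MI[OF B(1-3) y(1)] by simp
      then have "y = x j" using ij(3) B y(1) by (meson antichain_def order_trans)
      then show "i = j" using y(2) xM[OF ij(2)] by (simp add: M_def)
    qed
    show ?thesis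
    proof (cases "\<exists>i<k. x i \<le> a")
      case False
      let ?A = "insert a (x ` {..<k})"
      have "a \<notin> x ` {..<k}" using False by auto
      moreover have "inj_on x {..<k}" using xx by (auto simp: inj_on_def)
      ultimately have "card ?A = Suc k" by (simp add: card_image)
      moreover have sub: "?A \<subseteq> P" using xM a(1) P'(2) by (auto simp: M_def)
      moreover have "antichain ?A"
        unfolding antichain_def using False xx a(2) sub by fastforce
      ultimately have "Suc k \<le> n" using less(3) by metis
      moreover have "chain_cover (\<lambda>x. if x \<in> {a} then k else c x) P (Suc k)"
        using c unfolding P'_def by (rule chain_cover_add) auto
      ultimately have "chain_cover (\<lambda>x. if x \<in> {a} then k else c x) P n"
        unfolding chain_cover_def by (meson less_le_trans)
      then show ?thesis by blast
    next
      case True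
      then obtain i where i: "i < k" "x i \<le> a" by blast
      define K where "K = insert a {z \<in> P'. c z = i \<and> z \<le> x i}"
      have K: "y \<le> z \<or> z \<le> y" if "y \<in> K" "z \<in> K" for y z
        using that c i(2) unfolding K_def chain_cover_def by (auto intro: order_trans)
      \<comment> \<open>An antichain of size \<open>k\<close> avoiding \<open>K\<close> would meet
        chain \<open>i\<close> in an element of \<open>M i\<close>, which lies below
        \<open>x i\<close> and hence in \<open>K\<close>.\<close>
      have "card B \<le> k - 1" if B: "B \<subseteq> P - K" "antichain B" for B
      proof (rule ccontr)
        assume "\<not> card B \<le> k - 1"
        moreover have B': "B \<subseteq> P'" using B(1) by (auto simp: P'_def K_def)
        then have "card B \<le> k" using A0(2) B(2) by (simp add: k_def)
        ultimately have cB: "card B = k" by simp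
        then obtain y where y: "y \<in> B" "c y = i" using hit[OF B' B(2)] i(1) by (metis imageE lessThan_iff)
        then have "y \<le> x i" using xmax[OF i(1)] MI[OF B' B(2) cB y(1)] y(2) by simp
        then show False using y B' B(1) by (auto simp: K_def)
      qed
      moreover have "card (P - K) < card P"
        using a(1) less(2) by (intro psubset_card_mono) (auto simp: K_def)
      ultimately obtain d where "chain_cover d (P - K) (k - 1)" using less(1)[of "P - K" "k - 1"] less(2) by blast
      then have "chain_cover (\<lambda>x. if x \<in> K then k - 1 else d x) P (Suc (k - 1))"
        by (rule chain_cover_add) (rule K)
      moreover have "k \<le> n" using A0(1) less(3)[of A0] P'(2) by (auto simp: k_def)
      ultimately have "chain_cover (\<lambda>x. if x \<in> K then k - 1 else d x) P n"
        using i(1) unfolding chain_cover_def by (auto intro: less_le_trans)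
      then show ?thesis by blast
    qed
  qed
qed

section \<open>Normal forms of paths\<close>

locale cat0_cube =
  fixes C :: "'v set set"
  assumes cat0: "CAT0_cube_complex C"
begin

lemma cc: "cube_complex C"
  using cat0 by (simp add: CAT0_cube_complex_def)

lemma flag:
  assumes "v \<in> \<Union>C" "finite N" "\<forall>x\<in>N. is_edge C v x"
    "\<forall>x\<in>N. \<forall>y\<in>N. x \<noteq> y \<longrightarrow> (\<exists>Q\<in>C. card Q = 4 \<and> {v, x, y} \<subseteq> Q)"
  shows "\<exists>Q\<in>C. card Q = 2 ^ card N \<and> insert v N \<subseteq> Q"
proof -
  have "flag_links C" using cat0 by (simp add: CAT0_cube_complex_def)
  then show ?thesis
    unfolding flag_links_def by (elim allE[of _ v] allE[of _ N] mp) (intro conjI assms)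
qed

lemma chart_at_exists:
  assumes "Q \<in> C" "u \<in> Q"
  shows "\<exists>I g. chart_at C Q I g u"
proof -
  obtain I f where f: "cube_chart C Q I f" using cc assms(1) by (auto simp: cube_complex_def)
  then have "Q = f ` Pow I" by (simp add: cube_chart_def bij_betw_def)
  then obtain A where "A \<subseteq> I" "u = f A" using assms(2) by auto
  then show ?thesis using cube_chart_rebase[OF f] by blast
qed

lemma card_cube: "Q \<in> C \<Longrightarrow> \<exists>k. card Q = 2 ^ k"
proof -
  assume Q: "Q \<in> C"
  moreover have "Q \<noteq> {}" using cc Q by (auto simp: cube_complex_def)
  ultimately show ?thesis using chart_at_exists chart_at_card by fast
qed

text \<open>Otherwise the two squares would meet in a cube with three vertices, and 3 is not a power
  of 2.\<close>

lemma sq_unique: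
  assumes 1: "sq C a b c d" and 2: "sq C a b c' d"
  shows "c = c'"
proof (rule ccontr)
  assume ne: "c \<noteq> c'"
  have "{a, b, c, d} \<inter> {a, b, c', d} \<in> C"
    using 1 2 cc unfolding sq_def cube_complex_def by (metis disjoint_iff insertI1)
  moreover have "{a, b, c, d} \<inter> {a, b, c', d} = {a, b, d}"
    using ne sq_distinct[OF 1] sq_distinct[OF 2] by auto
  moreover have "card {a, b, d} = 3" using sq_distinct[OF 1] by simp
  ultimately obtain k :: nat where k: "3 = (2::nat) ^ k" using card_cube by metis
  then have "odd ((2::nat) ^ k)" by (metis odd_numeral)
  then have "k = 0" by (cases k) auto
  then show False using k by simp
qed

text \<open>The three edges at \<open>u\<close> pairwise span squares, so they span a 3-cube, and \<open>z\<close> is its vertex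
opposite to \<open>u\<close>.\<close>

lemma cube3:
  assumes 1: "sq C y x t u" and 2: "sq C y u t' u'" and 3: "sq C u t s t'"
  shows "\<exists>z. sq C y x z u' \<and> sq C x t s z \<and> sq C u' t' s z"
proof -
  have ne: "y \<noteq> t" "y \<noteq> t'" "t \<noteq> t'" using sq_distinct[OF 1] sq_distinct[OF 2] sq_distinct[OF 3] by auto
  let ?N = "{y, t, t'}"
  have N: "card ?N = 3" using ne by simp
  have e: "\<forall>x\<in>?N. is_edge C u x"
    using 1 2 3 by (auto simp: sq_def intro: is_edge_sym)
  define P where "P a b \<longleftrightarrow> (\<exists>Q\<in>C. card Q = 4 \<and> {u, a, b} \<subseteq> Q)" for a b
  have "P y t" "P y t'" "P t t'" using 1 2 3 unfolding sq_def P_def by blast+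
  moreover from this have "P t y" "P t' y" "P t' t" by (simp_all add: P_def insert_commute)
  ultimately have "\<forall>x\<in>?N. \<forall>y\<in>?N. x \<noteq> y \<longrightarrow> P x y" by simp
  moreover have "u \<in> \<Union>C" using is_edge_vertices[OF sq_edges(1)[OF 3]] by simp
  ultimately have "\<exists>Q\<in>C. card Q = 2 ^ card ?N \<and> insert u ?N \<subseteq> Q"
    using e by (intro flag) (simp_all only: P_def finite.intros)
  then obtain Q where Q: "Q \<in> C" "insert u ?N \<subseteq> Q" by blast
  then obtain I g where g: "chart_at C Q I g u" using chart_at_exists by blast
  obtain i j k where ijk: "i \<in> I" "j \<in> I" "k \<in> I" "y = g {i}" "t = g {j}" "t' = g {k}"
    using chart_at_nbr[OF g] e Q(2) by (metis insert_subset insertI1 insertI2)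
  then have d: "i \<noteq> j" "i \<noteq> k" "j \<noteq> k" using ne by auto
  have u: "u = g {}" using g by (simp add: chart_at_def)
  note S = chart_at_sq[OF g]
  have "sq C u y (g {i,j}) t" using S[of "{}" i j] ijk d by (simp add: u)
  then have x: "x = g {i,j}" using sq_unique sq_rotate_back[OF 1] by metis
  have "sq C u y (g {i,k}) t'" using S[of "{}" i k] ijk d by (simp add: u)
  then have u': "u' = g {i,k}" using sq_unique sq_swap[OF 2] by metis
  have "sq C u t (g {j,k}) t'" using S[of "{}" j k] ijk d by (simp add: u)
  then have s: "s = g {j,k}" using sq_unique 3 by metis
  let ?z = "g {i,j,k}"
  have "sq C y x ?z u'" using S[of "{i}" j k] ijk d by (simp add: x u' insert_commute)
  moreover have "sq C t x ?z s" using S[of "{j}" i k] ijk d by (simp add: x s insert_commute)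
  then have "sq C x t s ?z" by (rule sq_swap)
  moreover have "sq C t' u' ?z s" using S[of "{k}" i j] ijk d by (simp add: u' s insert_commute)
  then have "sq C u' t' s ?z" by (rule sq_swap)
  ultimately show ?thesis by blast
qed

text \<open>Exchange property, the source of all later facts on reduced paths. The alternative is
  transitive: composing squares \<open>y x t u\<close> and \<open>y u t' u'\<close> leaves two
  equivalent shorter paths from \<open>u\<close> through \<open>t\<close> and \<open>t'\<close>, and
  induction yields \<open>t = t'\<close> or a third square at \<open>u\<close>. In the latter case
  \<open>cube3\<close> completes the 3-cube and its vertex \<open>z\<close> serves as the new
  corner.\<close>

lemma eqv_ConsE:
  assumes "eqv C (y # x # p) (y # u # q)"
  shows "(x = u \<and> eqv C (x # p) (u # q)) \<or>
    (\<exists>t r. sq C y x t u \<and> eqv C (x # p) (x # t # r) \<and> eqv C (u # q) (u # t # r))"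
  using assms
proof (induction "length p" arbitrary: y x p u q rule: less_induct)
  case less
  define E where "E x p u q \<longleftrightarrow> (x = u \<and> eqv C (x # p) (u # q)) \<or>
    (\<exists>t r. sq C y x t u \<and> eqv C (x # p) (x # t # r) \<and> eqv C (u # q) (u # t # r))" for x p u q
  have E_trans: "E x p u' q'" if E1: "E x p u q" and E2: "E u q u' q'" for u q u' q'
    using E1[unfolded E_def]
  proof
    assume "x = u \<and> eqv C (x # p) (u # q)"
    then show ?thesis using E2 unfolding E_def by (metis eqv_trans)
  next
    assume "\<exists>t r. sq C y x t u \<and> eqv C (x # p) (x # t # r) \<and> eqv C (u # q) (u # t # r)"
    then obtain t r where 1: "sq C y x t u" "eqv C (x # p) (x # t # r)" "eqv C (u # q) (u # t # r)"
      by blast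
    show ?thesis using E2[unfolded E_def]
    proof
      assume "u = u' \<and> eqv C (u # q) (u' # q')"
      then show ?thesis using 1 unfolding E_def by (metis eqv_trans eqv_sym)
    next
      assume "\<exists>t r. sq C y u t u' \<and> eqv C (u # q) (u # t # r) \<and> eqv C (u' # q') (u' # t # r)"
      then obtain t' r' where 2: "sq C y u t' u'" "eqv C (u # q) (u # t' # r')"
        "eqv C (u' # q') (u' # t' # r')" by blast
      have "eqv C (u # t # r) (u # t' # r')" using 1 2 by (metis eqv_trans eqv_sym)
      from less(1)[OF _ this] eqv_hd_length[OF 1(2)] consider "t = t'" "eqv C (t # r) (t' # r')" |
        s k where "sq C u t s t'" "eqv C (t # r) (t # s # k)" "eqv C (t' # r') (t' # s # k)"
        by auto
      then show ?thesis
      proof cases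
        case 1
        \<comment> \<open>With \<open>t = t'\<close> both squares have the corner
          \<open>y, u, t\<close>, so they coincide and the two changes of the first step undo each
          other.\<close>
        have "sq C u y x t" using \<open>sq C y x t u\<close> by (rule sq_rotate_back)
        moreover have "sq C u y u' t" using sq_swap[OF 2(1)] 1(1) by simp
        ultimately have "x = u'" by (rule sq_unique)
        moreover have "eqv C (x # t # r) (x # t' # r')" using 1 by (intro eqv_Cons)
        ultimately show ?thesis unfolding E_def
          using \<open>eqv C (x # p) (x # t # r)\<close> 2 by (metis eqv_trans eqv_sym)
      next
        case (2 s k)
        then obtain z where z: "sq C y x z u'" "sq C x t s z" "sq C u' t' s z"
          using cube3 \<open>sq C y x t u\<close> \<open>sq C y u t' u'\<close> by blast
        have "eqv C (x # p) (x # t # s # k)"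
          using \<open>eqv C (x # p) (x # t # r)\<close> 2(2) eqv_Cons eqv_trans by metis
        then have a: "eqv C (x # p) (x # z # s # k)" using eqv_sq[OF z(2)] eqv_trans by metis
        have "eqv C (u' # q') (u' # t' # s # k)"
          using \<open>eqv C (u' # q') (u' # t' # r')\<close> 2(3) eqv_Cons eqv_trans by metis
        then have "eqv C (u' # q') (u' # z # s # k)" using eqv_sq[OF z(3)] eqv_trans by metis
        then show ?thesis unfolding E_def using z(1) a by blast
      qed
    qed
  qed
  have E_step: "E u q u' q'" if "square_swap C (y # u # q) (y # u' # q')" for u q u' q'
    using that
  proof (cases rule: square_swap.cases)
    case (here c r)
    then show ?thesis unfolding E_def by (metis eqv_refl list.inject)
  next
    case there
    then show ?thesis unfolding E_def using square_swap_hd_length square_swap_eqv by fastforce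
  qed
  \<comment> \<open>Each path in the sequence of exchanges is compared with the first one; a further
    exchange is absorbed by \<open>E_trans\<close>.\<close>
  have "\<exists>u q. ps = y # u # q \<and> E x p u q" if "(square_swap C)\<^sup>*\<^sup>* (y # x # p) ps" for ps
    using that
  proof (induction rule: rtranclp_induct)
    case base
    show ?case by (auto simp: E_def)
  next
    case (step ps qs)
    then obtain u q where uq: "ps = y # u # q" "E x p u q" by blast
    then have "hd qs = y" "length qs = Suc (Suc (length q))" using square_swap_hd_length[OF step(2)] by auto
    then obtain u' q' where "qs = y # u' # q'"
      by (metis length_Suc_conv list.sel(1))
    then show ?case using E_trans[OF uq(2)] E_step step(2) uq(1) by blast
  qed
  then have "E x p u q" using less(2) by (fastforce simp: eqv_def)
  then show ?case by (simp add: E_def)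
qed

lemma eqv_cancel: "eqv C (y # x # p) (y # x # q) \<Longrightarrow> eqv C (x # p) (x # q)"
  using eqv_ConsE sq_distinct(5) by metis

text \<open>Deletion property: if a new step spoils reducedness, the old path could already be
  rewritten so that this step cancels its first edge. If a representative backtracks only later, the
  new edge is moved across a square, the shorter path is treated by induction, and the square is
  flipped back.\<close>

lemma reduced_Cons:
  assumes "reduced C (x # p)" "\<not> reduced C (y # x # p)"
  shows "\<exists>q. eqv C (x # p) (x # y # q)"
  using assms
proof (induction "length p" arbitrary: y x p rule: less_induct)
  case less
  obtain b where b: "eqv C (y # x # p) b" "has_backtrack b" using less(3) by (auto simp: reduced_def)
  obtain b1 where "b = y # b1" using eqv_ConsD[OF b(1)] by blast
  moreover have "b1 \<noteq> []" using eqv_hd_length[OF b(1)] \<open>b = _\<close> by auto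
  ultimately obtain d b' where bb: "b = y # d # b'" by (cases b1) auto
  from b(2) show ?case unfolding bb
  proof cases
    case (bt_here b'')
    then have "eqv C (y # x # p) (y # d # y # b'')" using b(1) bb by simp
    then consider "x = d" "eqv C (x # p) (d # y # b'')" |
      t r where "sq C y x t d" "eqv C (x # p) (x # t # r)" "eqv C (d # y # b'') (d # t # r)"
      using eqv_ConsE by blast
    then show ?thesis
    proof cases
      case 1
      then show ?thesis by auto
    next
      case (2 t r)
      \<comment> \<open>A second exchange at \<open>d\<close> produces a square with corner
        \<open>d, y, t\<close>; its fourth vertex must be \<open>x\<close>, which exposes the
        backtrack \<open>x t x\<close> in a reduced path.\<close>
      have "y \<noteq> t" using sq_distinct[OF 2(1)] by simp
      then obtain s k where s: "sq C d y s t" "eqv C (t # r) (t # s # k)"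
        using eqv_ConsE[OF 2(3)] by blast
      have "sq C d y x t" using 2(1) by (rule sq_rotate_back)
      then have "s = x" using s(1) sq_unique by blast
      then have "eqv C (x # p) (x # t # x # k)" using 2(2) s(2) eqv_Cons eqv_trans by metis
      then have False using less(2) reduced_eqv not_red_bt by metis
      then show ?thesis ..
    qed
  next
    case bt_there
    consider "x = d" "eqv C (x # p) (d # b')" |
      t r where "sq C y x t d" "eqv C (x # p) (x # t # r)" "eqv C (d # b') (d # t # r)"
      using eqv_ConsE b(1) bb by blast
    then show ?thesis
    proof cases
      case 1
      then show ?thesis using bt_there less(2) by (auto simp: reduced_def)
    next
      case (2 t r)
      have "reduced C (t # r)" using 2(2) less(2) reduced_ConsD reduced_eqv by metis
      moreover have "\<not> reduced C (d # t # r)" using 2(3) bt_there eqv_sym unfolding reduced_def by blast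
      moreover have "length r < length p" using eqv_hd_length[OF 2(2)] by simp
      ultimately obtain q where "eqv C (t # r) (t # d # q)" using less(1) by blast
      then have "eqv C (x # p) (x # t # d # q)" using 2(2) eqv_Cons eqv_trans by metis
      moreover have "sq C x t d y" using 2(1) by (rule sq_rotate)
      ultimately show ?thesis using eqv_sq eqv_trans by metis
    qed
  qed
qed

text \<open>The van der Waerden trick: \<open>ext y\<close> lets a step to \<open>y\<close> act on classes of reduced paths. Paths
are extended at the head, so the base point is the last element of the list.\<close>

definition ext :: "'v \<Rightarrow> 'v list \<Rightarrow> 'v list" where
  "ext y q = (if \<exists>x r. eqv C q (x # y # r) then y # (SOME r. \<exists>x. eqv C q (x # y # r)) else y # q)"

primrec nf :: "'v list \<Rightarrow> 'v list" where
  "nf [] = []"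
| "nf (x # p) = (if p = [] then [x] else ext x (nf p))"

text \<open>By \<open>eqv_cancel\<close> the tail picked by \<open>SOME\<close> is determined up to
  \<open>eqv\<close> once its head \<open>y\<close> is put in front.\<close>

lemma ext_down:
  assumes "eqv C q (x # y # r)"
  shows "eqv C (ext y q) (y # r)"
proof -
  define r' where "r' = (SOME r. \<exists>x. eqv C q (x # y # r))"
  have "\<exists>r x. eqv C q (x # y # r)" using assms by blast
  then have "\<exists>x. eqv C q (x # y # r')" unfolding r'_def by (rule someI_ex)
  then obtain x' where x': "eqv C q (x' # y # r')" by blast
  then have e: "eqv C (x' # y # r') (x # y # r)" using assms eqv_sym eqv_trans by metis
  then have "x' = x" using eqv_hd_length by fastforce
  then have "eqv C (y # r') (y # r)" using e eqv_cancel by blast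
  moreover have "ext y q = y # r'" unfolding ext_def r'_def using assms by auto
  ultimately show ?thesis by simp
qed

lemma ext_up: "\<nexists>x r. eqv C q (x # y # r) \<Longrightarrow> ext y q = y # q"
  by (simp add: ext_def)

lemma ext_cong:
  assumes "eqv C q q'"
  shows "eqv C (ext y q) (ext y q')"
proof (cases "\<exists>x r. eqv C q (x # y # r)")
  case True
  then obtain x r where r: "eqv C q (x # y # r)" by blast
  then have "eqv C q' (x # y # r)" using assms eqv_sym eqv_trans by metis
  then show ?thesis using r ext_down eqv_sym eqv_trans by metis
next
  case False
  then have "\<nexists>x r. eqv C q' (x # y # r)" using assms eqv_trans by metis
  then show ?thesis using False assms by (simp add: ext_up eqv_Cons)
qed

lemma ext_hd: "\<exists>r. ext y q = y # r"
  by (simp add: ext_def)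

lemma reduced_ext:
  assumes "reduced C q" "q \<noteq> []"
  shows "reduced C (ext y q)"
proof (cases "\<exists>x r. eqv C q (x # y # r)")
  case True
  then obtain x r where r: "eqv C q (x # y # r)" by blast
  have "reduced C (y # r)" using reduced_ConsD[OF reduced_eqv[OF assms(1) r]] .
  then show ?thesis by (rule reduced_eqv[OF _ eqv_sym[OF ext_down[OF r]]])
next
  case False
  moreover obtain x p where "q = x # p" using assms(2) by (cases q) auto
  ultimately show ?thesis using reduced_Cons[of x p y] assms(1) by (auto simp: ext_up)
qed

text \<open>The backtrack relation for the action. If \<open>y\<close> shortens the path, then
  \<open>x\<close> cannot shorten it again, since that would exhibit a backtrack
  \<open>x y x\<close>; so \<open>x\<close> is put back. If \<open>y\<close> lengthens it,
  \<open>x\<close> removes the new edge.\<close>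

lemma ext_backtrack:
  assumes "reduced C (x # p)"
  shows "eqv C (ext x (ext y (x # p))) (x # p)"
proof (cases "\<exists>x' r. eqv C (x # p) (x' # y # r)")
  case True
  then obtain x' r where r: "eqv C (x # p) (x' # y # r)" by blast
  then have [simp]: "x' = x" using eqv_hd_length by fastforce
  have "\<nexists>z k. eqv C (y # r) (z # x # k)"
  proof
    assume "\<exists>z k. eqv C (y # r) (z # x # k)"
    then obtain z k where k: "eqv C (y # r) (z # x # k)" by blast
    then have "z = y" using eqv_hd_length by fastforce
    then have "eqv C (x # p) (x # y # x # k)" using r k eqv_Cons eqv_trans \<open>x' = x\<close> by metis
    then show False using reduced_eqv[OF assms] not_red_bt by metis
  qed
  then have "eqv C (ext x (ext y (x # p))) (x # y # r)"
    using ext_cong[OF ext_down[OF r]] ext_up by metis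
  then show ?thesis using r eqv_trans eqv_sym \<open>x' = x\<close> by metis
next
  case False
  then have "eqv C (ext y (x # p)) (y # x # p)" by (simp add: ext_up)
  then show ?thesis by (rule ext_down)
qed

text \<open>If \<open>u\<close> shortened the path after \<open>y\<close> was added, the exchange
  property would give a square on \<open>x, y, u\<close>, whose fourth vertex is \<open>z\<close>,
  and \<open>z\<close> would have shortened the original path.\<close>

lemma ext_square_up:
  assumes sq: "sq C x y u z" and q: "\<nexists>x' r. eqv C (x # p) (x' # z # r)"
  shows "ext u (y # x # p) = u # y # x # p"
proof (rule ext_up, rule notI)
  assume "\<exists>x' r. eqv C (y # x # p) (x' # u # r)"
  then obtain x' r where r: "eqv C (y # x # p) (x' # u # r)" by blast
  then have "x' = y" using eqv_hd_length by fastforce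
  then have "eqv C (y # x # p) (y # u # r)" using r by simp
  moreover have "x \<noteq> u" using sq_distinct[OF sq] by simp
  ultimately obtain t k where t: "sq C y x t u" "eqv C (x # p) (x # t # k)"
    using eqv_ConsE by blast
  have "t = z" using sq_unique[OF t(1) sq_swap[OF sq]] .
  then show False using t q by blast
qed

text \<open>One side of the square shortens and the other lengthens; both routes then arrive at the
  class of \<open>u # y # r\<close>.\<close>

lemma ext_square_mixed:
  assumes sq: "sq C x y u z" and y: "eqv C (x # p) (x # y # r)"
    and z: "\<nexists>x' r. eqv C (x # p) (x' # z # r)"
  shows "eqv C (ext u (ext y (x # p))) (u # y # r)" "eqv C (ext u (ext z (x # p))) (u # y # r)"
proof -
  have "\<nexists>y' k. eqv C (y # r) (y' # u # k)"
  proof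
    assume "\<exists>y' k. eqv C (y # r) (y' # u # k)"
    then obtain y' k where k: "eqv C (y # r) (y' # u # k)" by blast
    then have "y' = y" using eqv_hd_length by fastforce
    then have "eqv C (x # p) (x # y # u # k)" using y k eqv_Cons eqv_trans by metis
    then show False using z eqv_sq[OF sq] eqv_trans by metis
  qed
  then show "eqv C (ext u (ext y (x # p))) (u # y # r)"
    using ext_cong[OF ext_down[OF y]] ext_up by metis
  have "eqv C (z # x # p) (z # x # y # r)" using y by (rule eqv_Cons)
  then have "eqv C (z # x # p) (z # u # y # r)"
    using eqv_sq[OF sq_rotate_back[OF sq]] eqv_trans by metis
  then show "eqv C (ext u (ext z (x # p))) (u # y # r)"
    using ext_down ext_up[OF z] by metis
qed

text \<open>The commutation relation for the action. When both \<open>y\<close> and \<open>z\<close>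
  shorten the path, the exchange property supplies a square on \<open>x, y, z\<close>, necessarily
  the given one, so both routes descend to \<open>u # m\<close>.\<close>

lemma ext_square:
  assumes sq: "sq C x y u z"
  shows "eqv C (ext u (ext y (x # p))) (ext u (ext z (x # p)))"
proof -
  let ?down = "\<lambda>y. \<exists>x' r. eqv C (x # p) (x' # y # r)"
  have downE: "\<exists>r. eqv C (x # p) (x # y # r)" if "?down y" for y
    using that eqv_hd_length by fastforce
  consider "\<not> ?down y" "\<not> ?down z" | "?down y" "\<not> ?down z" | "\<not> ?down y" "?down z"
    | "?down y" "?down z" by blast
  then show ?thesis
  proof cases
    case 1
    then have "ext u (ext y (x # p)) = u # y # x # p" "ext u (ext z (x # p)) = u # z # x # p"
      using ext_square_up[OF sq] ext_square_up[OF sq_flip[OF sq]] ext_up by simp_all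
    moreover have "sq C u y x z" by (rule sq_flip[OF sq_rotate[OF sq_rotate[OF sq]]])
    ultimately show ?thesis by (simp add: eqv_sq)
  next
    case 2
    then obtain r where "eqv C (x # p) (x # y # r)" using downE by blast
    from ext_square_mixed[OF sq this 2(2)] show ?thesis using eqv_trans eqv_sym by blast
  next
    case 3
    then obtain r where "eqv C (x # p) (x # z # r)" using downE by blast
    from ext_square_mixed[OF sq_flip[OF sq] this 3(1)] show ?thesis using eqv_trans eqv_sym by blast
  next
    case 4
    then obtain r k where r: "eqv C (x # p) (x # y # r)" and k: "eqv C (x # p) (x # z # k)"
      using downE by blast
    have "y \<noteq> z" using sq_distinct[OF sq] by simp
    moreover have "eqv C (x # y # r) (x # z # k)" using r k eqv_sym eqv_trans by metis
    ultimately obtain t m where t: "sq C x y t z" "eqv C (y # r) (y # t # m)" "eqv C (z # k) (z # t # m)"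
      using eqv_ConsE by blast
    have "t = u" using sq_unique[OF t(1) sq] .
    then have "eqv C (ext y (x # p)) (y # u # m)" "eqv C (ext z (x # p)) (z # u # m)"
      using t eqv_trans[OF ext_down[OF r]] eqv_trans[OF ext_down[OF k]] by simp_all
    from ext_down[OF this(1)] eqv_sym[OF ext_down[OF this(2)]] show ?thesis by (rule eqv_trans)
  qed
qed

lemma has_backtrack_length: "has_backtrack p \<Longrightarrow> length p \<ge> 3"
  by (induction rule: has_backtrack.induct) auto

lemma reduced_nf: "p \<noteq> [] \<Longrightarrow> reduced C (nf p) \<and> (\<exists>r. nf p = hd p # r)"
proof (induction p)
  case (Cons x p)
  have "reduced C [x]"
    unfolding reduced_def using has_backtrack_length eqv_hd_length by fastforce
  then show ?case using Cons ext_hd reduced_ext by auto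
qed simp

text \<open>On a reduced path every step lengthens: a shortening one would reveal a
  backtrack.\<close>

lemma nf_reduced: "reduced C p \<Longrightarrow> eqv C (nf p) p"
proof (induction p)
  case (Cons y p)
  show ?case
  proof (cases p)
    case (Cons x p')
    have "eqv C (nf p) p" using Cons.IH reduced_ConsD[OF Cons.prems] by simp
    then have "eqv C (nf (y # p)) (ext y p)" using Cons ext_cong by simp
    moreover have "\<nexists>x' r. eqv C p (x' # y # r)"
    proof
      assume "\<exists>x' r. eqv C p (x' # y # r)"
      then obtain x' r where "eqv C p (x' # y # r)" by blast
      then have "eqv C (y # p) (y # x' # y # r)" by (rule eqv_Cons)
      then show False using reduced_eqv[OF Cons.prems] not_red_bt by metis
    qed
    ultimately show ?thesis by (simp add: ext_up)
  qed simp
qed simp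

lemma nf_append_cong:
  assumes "eqv C (nf r) (nf r')" "r \<noteq> []" "r' \<noteq> []"
  shows "eqv C (nf (l @ r)) (nf (l @ r'))"
  using assms by (induction l) (auto intro: ext_cong)

lemma nf_htpy_step: "htpy_step C p q \<Longrightarrow> eqv C (nf p) (nf q)"
proof (induction rule: htpy_step.induct)
  case (backtrack x y p q)
  obtain r where "reduced C (nf (x # q))" "nf (x # q) = x # r" using reduced_nf[of "x # q"] by auto
  then have "eqv C (nf (x # q)) (nf (x # y # x # q))"
    using ext_backtrack[of x r y] by (simp del: nf.simps add: nf.simps(2)[of _ "_ # _"] eqv_sym)
  then show ?case using nf_append_cong[of "x # q" "x # y # x # q" p] by (simp del: nf.simps)
next
  case (square a b c d p q)
  obtain r where r: "nf (c # q) = c # r" using reduced_nf[of "c # q"] by auto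
  have "{c, b, a, d} = {a, b, c, d}" by auto
  \<comment> \<open>Paths grow at the head, so the base of the square is \<open>c\<close> and it is
    read backwards.\<close>
  then have "sq C c b a d" using square by (auto simp: sq_def intro: is_edge_sym)
  then have "eqv C (ext a (ext b (c # r))) (ext a (ext d (c # r)))" by (rule ext_square)
  then have "eqv C (nf (a # b # c # q)) (nf (a # d # c # q))"
    by (simp del: nf.simps add: nf.simps(2)[of _ "_ # _"] r)
  then show ?case using nf_append_cong[of "a # b # c # q" "a # d # c # q" p] by (simp del: nf.simps)
qed

lemma nf_homotopic: "homotopic_paths C p q \<Longrightarrow> eqv C (nf p) (nf q)"
  unfolding homotopic_paths_def
  by (induction rule: rtranclp_induct) (auto dest: nf_htpy_step intro: eqv_trans eqv_sym)

section \<open>Concatenation, reversal and contraction of walks\<close>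

lemma htpy_step_context: "htpy_step C p q \<Longrightarrow> htpy_step C (l @ p @ r) (l @ q @ r)"
proof (induction rule: htpy_step.induct)
  case (backtrack x y p q)
  then show ?case using htpy_step.backtrack[of C x y "l @ p" "q @ r"] by simp
next
  case (square a b c d p q)
  then show ?case using htpy_step.square[of a b c d C "l @ p" "q @ r"] by simp
qed

lemma homotopic_context: "homotopic_paths C p q \<Longrightarrow> homotopic_paths C (l @ p @ r) (l @ q @ r)"
  unfolding homotopic_paths_def
proof (induction rule: rtranclp_induct)
  case (step y z)
  have "htpy_step C (l @ y @ r) (l @ z @ r) \<or> htpy_step C (l @ z @ r) (l @ y @ r)"
    using step(2) htpy_step_context by blast
  with step(3) show ?case by (rule rtranclp.rtrancl_into_rtrancl)
qed simp

lemma walk_single [simp]: "walk C [x] \<longleftrightarrow> x \<in> \<Union>C"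
  by (auto simp: walk_def)

lemma walk_Cons: "walk C (x # y # p) \<longleftrightarrow> is_edge C x y \<and> walk C (y # p)"
proof -
  have "(\<forall>i. Suc i < length (x # y # p) \<longrightarrow> is_edge C ((x # y # p) ! i) ((x # y # p) ! Suc i)) \<longleftrightarrow>
    is_edge C x y \<and> (\<forall>i. Suc i < length (y # p) \<longrightarrow> is_edge C ((y # p) ! i) ((y # p) ! Suc i))"
    (is "?l = ?r")
  proof
    assume l: ?l
    have "is_edge C x y" using l[rule_format, of 0] by simp
    moreover have "is_edge C ((y # p) ! i) ((y # p) ! Suc i)" if "Suc i < length (y # p)" for i
      using l[rule_format, of "Suc i"] that by simp
    ultimately show ?r by blast
  next
    assume r: ?r
    show ?l
    proof (intro allI impI)
      fix i assume "Suc i < length (x # y # p)"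
      then show "is_edge C ((x # y # p) ! i) ((x # y # p) ! Suc i)"
        using r by (cases i) auto
    qed
  qed
  then show ?thesis using is_edge_vertices[of C x y] unfolding walk_def by auto
qed

lemma walk_append:
  "p \<noteq> [] \<Longrightarrow> q \<noteq> [] \<Longrightarrow> walk C (p @ q) \<longleftrightarrow> walk C p \<and> walk C q \<and> is_edge C (last p) (hd q)"
proof (induction p)
  case (Cons x p)
  show ?case
  proof (cases p)
    case Nil
    then show ?thesis using Cons.prems is_edge_vertices[of C x "hd q"] by (cases q) (auto simp: walk_Cons)
  next
    case (Cons y p')
    then show ?thesis using Cons.IH Cons.prems by (auto simp: walk_Cons)
  qed
qed simp

lemma walk_rev: "walk C p \<Longrightarrow> walk C (rev p)"
proof (induction p)
  case (Cons x p)
  show ?case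
  proof (cases p)
    case (Cons y p')
    have "is_edge C x y" "walk C p" using Cons.prems Cons by (auto simp: walk_Cons)
    then have "walk C (rev p)" "is_edge C y x" "x \<in> \<Union>C" "last (rev p) = y" "rev p \<noteq> []"
      using Cons.IH is_edge_sym is_edge_vertices[of C x y] Cons by (auto simp: last_rev)
    then have "walk C (rev p @ [x])" by (subst walk_append) simp_all
    then show ?thesis by simp
  qed (use Cons in simp)
qed simp

lemma walk_concat:
  assumes "walk C p" "walk C q" "last p = hd q"
  shows "walk C (p @ tl q)" "hd (p @ tl q) = hd p" "last (p @ tl q) = last q"
proof -
  have p: "p \<noteq> []" using assms(1) by (auto simp: walk_def)
  obtain x q' where q: "q = x # q'" using assms(2) by (cases q) (auto simp: walk_def)
  show "walk C (p @ tl q)" using assms p q by (cases q') (simp_all add: walk_append walk_Cons)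
  show "hd (p @ tl q) = hd p" using p by simp
  show "last (p @ tl q) = last q" using assms q p by (cases q') auto
qed

text \<open>The path goes back along \<open>q\<close> and forth again; its turning point
  \<open>hd q\<close> is an innermost backtrack, and removing it leaves the same path for
  \<open>tl q\<close>.\<close>

lemma homotopic_rev: "walk C q \<Longrightarrow> homotopic_paths C (rev q @ tl q) [last q]"
proof (induction q)
  case (Cons y q)
  show ?case
  proof (cases q)
    case Nil
    then show ?thesis by (simp add: homotopic_paths_def)
  next
    case (Cons z q')
    have e: "is_edge C z y" and "walk C q" using Cons.prems Cons by (auto simp: walk_Cons is_edge_sym)
    then have "homotopic_paths C (rev q @ tl q) [last q]" using Cons.IH by blast
    moreover have "htpy_step C (rev q' @ [z] @ q') (rev q' @ [z, y, z] @ q')"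
      using e by (rule htpy_step.backtrack)
    then have "htpy_step C (rev q @ tl q) (rev (y # q) @ tl (y # q))" using Cons by simp
    ultimately show ?thesis unfolding homotopic_paths_def using Cons
      by (auto intro: converse_rtranclp_into_rtranclp)
  qed
qed (simp add: walk_def)

lemma closed_walk_contractible: "walk C p \<Longrightarrow> hd p = last p \<Longrightarrow> homotopic_paths C p [hd p]"
  using cat0 unfolding CAT0_cube_complex_def simply_connected_cc_def by blast

lemma closing_walk:
  assumes p: "walk C p" and q: "walk C q" and hl: "hd p = hd q" "last p = last q"
  shows "homotopic_paths C (p @ tl (rev q)) [hd p]"
proof -
  have "p \<noteq> []" "q \<noteq> []" using p q by (auto simp: walk_def)
  have w: "walk C (rev q)" using q by (rule walk_rev)
  have "hd (rev q) = last p" "last (rev q) = hd p" using hl \<open>q \<noteq> []\<close> by (auto simp: hd_rev last_rev)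
  then have "walk C (p @ tl (rev q))" "hd (p @ tl (rev q)) = hd p" "last (p @ tl (rev q)) = hd p"
    using walk_concat[OF p w] by simp_all
  then show ?thesis using closed_walk_contractible by metis
qed

text \<open>The path \<open>p\<close> followed by the reverse of \<open>q\<close> and then
  \<open>q\<close> contracts to \<open>q\<close>, because its first two parts form a loop, and to
  \<open>p\<close> by \<open>homotopic_rev\<close>. So \<open>p\<close> and \<open>q\<close> have
  equivalent normal forms, and reduced paths are equivalent to theirs.\<close>

lemma reduced_walk_unique:
  assumes p: "walk C p" "reduced C p" and q: "walk C q" "reduced C q" and hl: "hd p = hd q" "last p = last q"
  shows "eqv C p q"
proof -
  have ne: "p \<noteq> []" "q \<noteq> []" using p q by (auto simp: walk_def)
  have "homotopic_paths C (p @ tl (rev q)) [hd p]" using p q hl by (intro closing_walk)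
  then have "homotopic_paths C ([] @ (p @ tl (rev q)) @ tl q) ([] @ [hd p] @ tl q)"
    by (rule homotopic_context)
  then have "homotopic_paths C (p @ tl (rev q) @ tl q) q" using hl ne by simp
  then have 1: "eqv C (nf (p @ tl (rev q) @ tl q)) (nf q)" by (rule nf_homotopic)
  have "rev q = last p # tl (rev q)" using hl ne by (metis hd_rev list.collapse rev_is_Nil_conv)
  then have "p @ tl (rev q) @ tl q = butlast p @ (rev q @ tl q) @ []"
    using ne by (metis append.assoc append_Cons append_Nil append_Nil2 append_butlast_last_id)
  moreover have "homotopic_paths C (butlast p @ (rev q @ tl q) @ []) (butlast p @ [last q] @ [])"
    using homotopic_rev[OF q(1)] by (rule homotopic_context)
  moreover have "butlast p @ [last q] @ [] = p" using hl ne by (metis append_Nil2 append_butlast_last_id)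
  ultimately have "homotopic_paths C (p @ tl (rev q) @ tl q) p" by (simp only:)
  then have "eqv C (nf (p @ tl (rev q) @ tl q)) (nf p)" by (rule nf_homotopic)
  then show ?thesis using 1 nf_reduced p(2) q(2) eqv_sym eqv_trans by metis
qed

section \<open>The quadrangle condition\<close>

text \<open>The edge-path metric; a walk with \<open>n\<close> edges lists \<open>Suc n\<close>
  vertices.\<close>

definition dist :: "'v \<Rightarrow> 'v \<Rightarrow> nat" where
  "dist x y = (LEAST n. \<exists>p. walk C p \<and> hd p = x \<and> last p = y \<and> length p = Suc n)"

lemma dist_walk:
  assumes "x \<in> \<Union>C" "y \<in> \<Union>C"
  shows "\<exists>p. walk C p \<and> hd p = x \<and> last p = y \<and> length p = Suc (dist x y)"
proof -
  obtain p where p: "walk C p" "hd p = x" "last p = y"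
    using cat0 assms unfolding CAT0_cube_complex_def simply_connected_cc_def by meson
  then have "length p = Suc (length p - 1)" by (cases p) (auto simp: walk_def)
  then have "\<exists>n p. walk C p \<and> hd p = x \<and> last p = y \<and> length p = Suc n" using p by blast
  then show ?thesis unfolding dist_def by (rule LeastI_ex)
qed

lemma dist_le:
  assumes "walk C p" "hd p = x" "last p = y"
  shows "Suc (dist x y) \<le> length p"
proof -
  have l: "length p = Suc (length p - 1)" using assms by (cases p) (auto simp: walk_def)
  then have "dist x y \<le> length p - 1"
    unfolding dist_def using assms by (intro Least_le) blast
  then show ?thesis using l by simp
qed

lemma dist_self [simp]: "x \<in> \<Union>C \<Longrightarrow> dist x x = 0"
  using dist_le[of "[x]"] by simp

lemma dist_sym:
  assumes "x \<in> \<Union>C" "y \<in> \<Union>C"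
  shows "dist x y = dist y x"
proof -
  have "dist y x \<le> dist x y" if xy: "x \<in> \<Union>C" "y \<in> \<Union>C" for x y
  proof -
    obtain p where "walk C p" "hd p = x" "last p = y" "length p = Suc (dist x y)"
      using dist_walk[OF xy] by blast
    then show ?thesis
      using dist_le[OF walk_rev, of p y x] by (auto simp: hd_rev last_rev walk_def)
  qed
  then show ?thesis using assms by (simp add: order_antisym)
qed

lemma dist_triangle:
  assumes "x \<in> \<Union>C" "y \<in> \<Union>C" "z \<in> \<Union>C"
  shows "dist x z \<le> dist x y + dist y z"
proof -
  obtain p q where p: "walk C p" "hd p = x" "last p = y" "length p = Suc (dist x y)"
    and q: "walk C q" "hd q = y" "last q = z" "length q = Suc (dist y z)"
    using dist_walk assms by metis
  then show ?thesis using walk_concat[of p q] dist_le[of "p @ tl q" x z] by simp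
qed

lemma dist_edge: "is_edge C x y \<Longrightarrow> dist x y \<le> 1"
  using dist_le[of "[x, y]" x y] is_edge_vertices[of C x y] by (simp add: walk_Cons)

lemma dist_pred:
  assumes "x \<in> \<Union>C" "y \<in> \<Union>C" "x \<noteq> y"
  shows "\<exists>x'. is_edge C x x' \<and> dist x y = Suc (dist x' y)"
proof -
  obtain p where p: "walk C p" "hd p = x" "last p = y" "length p = Suc (dist x y)"
    using dist_walk assms by metis
  then obtain x' r where r: "p = x # x' # r" using assms(3) by (cases p; cases "tl p") (auto simp: walk_def)
  then have e: "is_edge C x x'" "walk C (x' # r)" using p by (auto simp: walk_Cons)
  then have "Suc (dist x' y) \<le> dist x y" using dist_le[of "x' # r" x' y] p r by simp
  moreover have "dist x y \<le> 1 + dist x' y"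
    using dist_triangle[of x x' y] dist_edge[OF e(1)] is_edge_vertices[OF e(1)] assms by simp
  ultimately show ?thesis using e by auto
qed

lemma homotopic_parity: "homotopic_paths C p q \<Longrightarrow> even (length p) = even (length q)"
  unfolding homotopic_paths_def
  by (induction rule: rtranclp_induct) (auto elim!: htpy_step.cases)

text \<open>The 1-skeleton is bipartite: equal distances would close up to a loop with an odd number
  of edges, while homotopy moves preserve parity and the constant path has none.\<close>

lemma dist_edge_neq:
  assumes e: "is_edge C x y" and z: "z \<in> \<Union>C"
  shows "dist z x \<noteq> dist z y"
proof
  assume d: "dist z x = dist z y"
  have xy: "x \<in> \<Union>C" "y \<in> \<Union>C" using is_edge_vertices[OF e] by auto
  obtain p q where p: "walk C p" "hd p = x" "last p = z" "length p = Suc (dist x z)"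
    and q: "walk C q" "hd q = y" "last q = z" "length q = Suc (dist y z)"
    using dist_walk xy z by metis
  obtain q' where "q = y # q'" using q by (cases q) (auto simp: walk_def)
  then have "walk C (x # q)" using q e by (simp add: walk_Cons)
  moreover have "last (x # q) = z" using q by (auto simp: walk_def)
  ultimately have "homotopic_paths C (p @ tl (rev (x # q))) [hd p]" using p by (intro closing_walk) auto
  then have "even (length (p @ tl (rev (x # q)))) = even (length [hd p])" by (rule homotopic_parity)
  moreover have "length p = length q" using d p q dist_sym xy z by simp
  ultimately show False by simp
qed

lemma dist_edge_cases:
  assumes e: "is_edge C x y" and z: "z \<in> \<Union>C"
  shows "dist z y = Suc (dist z x) \<or> dist z x = Suc (dist z y)"
proof -
  have "x \<in> \<Union>C" "y \<in> \<Union>C" using is_edge_vertices[OF e] by auto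
  then have "dist z y \<le> dist z x + 1" "dist z x \<le> dist z y + 1"
    using dist_triangle[of z x y] dist_triangle[of z y x] dist_edge[OF e] dist_edge[OF is_edge_sym[OF e]] z
    by simp_all
  then show ?thesis using dist_edge_neq[OF assms] by linarith
qed

lemma eqv_walk: "eqv C p q \<Longrightarrow> walk C p \<Longrightarrow> walk C q"
proof -
  have square_swap: "square_swap C p q \<Longrightarrow> walk C p \<Longrightarrow> walk C q" for p q
  proof (induction rule: square_swap.induct)
    case (here a b c d r)
    then have "is_edge C a d" "is_edge C d c" using sq_edges[OF here(1)] is_edge_sym by metis+
    then show ?case using here(2) by (auto simp: walk_Cons)
  next
    case (there p q x)
    then show ?case using square_swap_hd_length[OF there(1)] by (cases p; cases q) (auto simp: walk_Cons)
  qed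
  show "eqv C p q \<Longrightarrow> walk C p \<Longrightarrow> walk C q"
    unfolding eqv_def by (induction rule: rtranclp_induct) (auto intro: square_swap)
qed

lemma has_backtrack_shorten:
  "has_backtrack p \<Longrightarrow> walk C p \<Longrightarrow> \<exists>q. walk C q \<and> hd q = hd p \<and> last q = last p \<and> length q < length p"
proof (induction rule: has_backtrack.induct)
  case (bt_here a b r)
  then have "walk C (a # r)" by (auto simp: walk_Cons)
  then show ?case by force
next
  case (bt_there p x)
  obtain y p' where p: "p = y # p'" using bt_there(1) by (cases p) (auto elim: has_backtrack.cases)
  then have e: "is_edge C x y" "walk C p" using bt_there(3) by (auto simp: walk_Cons)
  then obtain q where q: "walk C q" "hd q = hd p" "last q = last p" "length q < length p"
    using bt_there(2) by blast
  then obtain q' where "q = y # q'" using p by (cases q) (auto simp: walk_def)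
  then have "walk C (x # q)" "last (x # q) = last (x # p)" using e q p by (auto simp: walk_Cons)
  then show ?case using q(4) by (intro exI[of _ "x # q"]) auto
qed

text \<open>Exchanges keep the length and the ends, and a backtrack could be cut out to give a
  shorter walk.\<close>

lemma geodesic_reduced:
  assumes p: "walk C p" "length p = Suc (dist (hd p) (last p))"
  shows "reduced C p"
  unfolding reduced_def
proof
  assume "\<exists>q. eqv C p q \<and> has_backtrack q"
  then obtain q where q: "eqv C p q" "has_backtrack q" by blast
  then obtain r where "walk C r" "hd r = hd q" "last r = last q" "length r < length q"
    using has_backtrack_shorten eqv_walk[OF q(1) p(1)] by blast
  then show False using dist_le[of r "hd p" "last p"] p eqv_hd_length[OF q(1)] by simp
qed

text \<open>Geodesics from \<open>y\<close> to \<open>z\<close> through \<open>x\<close> and through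
  \<open>u\<close> are both reduced, hence equivalent, and the exchange property at their first step
  gives the square. The rewritten path through \<open>x\<close> and \<open>t\<close> is still
  geodesic.\<close>

lemma quadrangle:
  assumes z: "z \<in> \<Union>C" and e: "is_edge C y x" "is_edge C y u" and ne: "x \<noteq> u"
    and d: "dist z y = Suc (dist z x)" "dist z y = Suc (dist z u)"
  shows "\<exists>t. sq C y x t u \<and> dist z x = Suc (dist z t)"
proof -
  have v: "x \<in> \<Union>C" "y \<in> \<Union>C" "u \<in> \<Union>C" using is_edge_vertices[OF e(1)] is_edge_vertices[OF e(2)] by auto
  have d': "dist y z = Suc (dist x z)" "dist y z = Suc (dist u z)" using d dist_sym v z by simp_all
  obtain p q where p: "walk C p" "hd p = x" "last p = z" "length p = Suc (dist x z)"
    and q: "walk C q" "hd q = u" "last q = z" "length q = Suc (dist u z)"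
    using dist_walk v z by metis
  obtain p' q' where p': "p = x # p'" and q': "q = u # q'"
    using p q by (metis list.collapse walk_def)
  have w: "walk C (y # p)" "walk C (y # q)" using p q e p' q' by (auto simp: walk_Cons)
  have "reduced C (y # p)" "reduced C (y # q)" using w p q d' p' q' by (auto intro!: geodesic_reduced)
  then have "eqv C (y # p) (y # q)" using w p q p' q' by (intro reduced_walk_unique) auto
  then obtain t r where t: "sq C y x t u" "eqv C (x # p') (x # t # r)"
    using ne eqv_ConsE p' q' by blast
  have "walk C (x # t # r)" "last (x # t # r) = z" "length (x # t # r) = Suc (dist x z)"
    using eqv_walk[OF t(2)] eqv_hd_length[OF t(2)] p p' by auto
  then have le: "Suc (dist t z) \<le> dist x z" using dist_le[of "t # r" t z] by (simp add: walk_Cons)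
  have et: "is_edge C x t" using sq_edges[OF t(1)] by simp
  have "Suc (dist z t) \<le> dist z x" using le dist_sym[of t z] dist_sym[of x z] is_edge_vertices[OF et] z by simp
  then have "dist z x = Suc (dist z t)" using dist_edge_cases[OF et z] by auto
  then show ?thesis using t(1) by blast
qed

section \<open>Halfspaces\<close>

lemma dist_eq_0D: "x \<in> \<Union>C \<Longrightarrow> y \<in> \<Union>C \<Longrightarrow> dist x y = 0 \<Longrightarrow> x = y"
  using dist_pred by fastforce

definition halfspace :: "'v \<Rightarrow> 'v \<Rightarrow> 'v set" where
  "halfspace a b = {z \<in> \<Union>C. dist z a < dist z b}"

lemma halfspace_iff: "is_edge C a b \<Longrightarrow> z \<in> \<Union>C \<Longrightarrow> z \<in> halfspace a b \<longleftrightarrow> dist z b = Suc (dist z a)"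
  using dist_edge_cases[of a b z] by (auto simp: halfspace_def)

lemma not_halfspace_iff:
  assumes "is_edge C a b" "z \<in> \<Union>C"
  shows "z \<notin> halfspace a b \<longleftrightarrow> dist z a = Suc (dist z b)"
  using halfspace_iff[OF assms] dist_edge_cases[OF assms] by linarith

lemma halfspace_flip: "is_edge C a b \<Longrightarrow> z \<in> \<Union>C \<Longrightarrow> z \<in> halfspace b a \<longleftrightarrow> z \<notin> halfspace a b"
  using halfspace_iff[OF is_edge_sym] not_halfspace_iff by metis

lemma halfspace_ends:
  assumes "is_edge C a b"
  shows "a \<in> halfspace a b" "b \<notin> halfspace a b"
  using dist_edge_neq[OF assms, of a] is_edge_vertices[OF assms] by (auto simp: halfspace_def)

text \<open>If \<open>z\<close> were nearer to \<open>a\<close> than to \<open>b\<close> but nearer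
  to \<open>c\<close> than to \<open>d\<close>, then both \<open>a\<close> and \<open>c\<close>
  would be nearer than \<open>b\<close>. The quadrangle at \<open>b\<close> has \<open>d\<close> as
  its fourth vertex, so \<open>d\<close> would be nearer than \<open>a\<close> and
  \<open>c\<close>.\<close>

lemma halfspace_sq_subset:
  assumes sq: "sq C a b c d"
  shows "halfspace a b \<subseteq> halfspace d c"
proof
  fix z assume zW: "z \<in> halfspace a b"
  have z: "z \<in> \<Union>C" using zW by (simp add: halfspace_def)
  note e = sq_edges[OF sq]
  have ab: "dist z b = Suc (dist z a)" using zW halfspace_iff[OF e(1) z] by simp
  show "z \<in> halfspace d c"
  proof (rule ccontr)
    assume "z \<notin> halfspace d c"
    then have dc: "dist z d = Suc (dist z c)" using not_halfspace_iff[OF is_edge_sym[OF e(3)] z] by simp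
    then have bc: "dist z b = Suc (dist z c)"
      using ab dist_edge_cases[OF e(2) z] dist_edge_cases[OF e(4) z] by presburger
    obtain t where t: "sq C b a t c" "dist z a = Suc (dist z t)"
      using quadrangle[OF z is_edge_sym[OF e(1)] e(2) _ ab bc] sq_distinct[OF sq] by blast
    have "t = d" using sq_unique[OF t(1) sq_swap[OF sq]] .
    then show False using t ab bc dc by simp
  qed
qed

lemma halfspace_sq: "sq C a b c d \<Longrightarrow> halfspace a b = halfspace d c"
  using halfspace_sq_subset[of a b c d] halfspace_sq_subset[of d c b a] sq_rotate[OF sq_flip[of C a b c d]] by blast

text \<open>A halfspace is determined by any one edge leaving it: \<open>a b\<close> is moved across
  squares, which keeps its halfspace, until it reaches \<open>x x'\<close>.\<close>

lemma halfspace_crossing: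
  assumes "is_edge C a b" "is_edge C x x'" "x \<in> halfspace a b" "x' \<notin> halfspace a b"
  shows "halfspace x x' = halfspace a b"
  using assms
proof (induction "dist x a" arbitrary: a b rule: less_induct)
  case less
  have v: "a \<in> \<Union>C" "b \<in> \<Union>C" "x \<in> \<Union>C" "x' \<in> \<Union>C"
    using is_edge_vertices[OF less(2)] is_edge_vertices[OF less(3)] by auto
  have xb: "dist x b = Suc (dist x a)" using halfspace_iff less v by simp
  have x'b: "dist x' a = Suc (dist x' b)" using not_halfspace_iff less v by simp
  have sx: "dist b x' = Suc (dist b x) \<or> dist b x = Suc (dist b x')"
    "dist a x' = Suc (dist a x) \<or> dist a x = Suc (dist a x')"
    using dist_edge_cases[OF less(3)] v by auto
  have s: "dist a x = dist x a" "dist a x' = dist x' a" "dist b x = dist x b" "dist b x' = dist x' b"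
    using dist_sym v by auto
  have x'a: "dist x' b = dist x a" using sx xb x'b unfolding s by presburger
  show ?case
  proof (cases "x = a")
    case True
    then have "x' = b" using x'a v dist_eq_0D by simp
    then show ?thesis using True by simp
  next
    case False
    then obtain a1 where a1: "is_edge C a a1" "dist a x = Suc (dist a1 x)"
      using dist_pred v by metis
    have va1: "a1 \<in> \<Union>C" using is_edge_vertices[OF a1(1)] by simp
    have s1: "dist a1 x = dist x a1" "dist a1 x' = dist x' a1" using dist_sym va1 v by auto
    have "dist a1 x' = Suc (dist a1 x) \<or> dist a1 x = Suc (dist a1 x')"
      "dist x' a = Suc (dist x' a1) \<or> dist x' a1 = Suc (dist x' a)"
      using dist_edge_cases[OF less(3) va1] dist_edge_cases[OF a1(1), of x'] v by auto
    then have d: "dist x' a = Suc (dist x' a1)" using x'a a1(2) x'b unfolding s s1 by presburger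
    have ne: "b \<noteq> a1" using a1(2) xb unfolding s s1 by auto
    \<comment> \<open>The quadrangle is based at \<open>x'\<close>: from \<open>a\<close>, both the
      other end \<open>b\<close> and the step \<open>a1\<close> towards \<open>x\<close> come closer
      to \<open>x'\<close>.\<close>
    obtain t where t: "sq C a b t a1" using quadrangle[OF v(4) less(2) a1(1) ne x'b d] by blast
    have eq: "halfspace a b = halfspace a1 t" using halfspace_sq[OF t] .
    have "is_edge C a1 t" using sq_edges(3)[OF t] by (rule is_edge_sym)
    moreover have "dist x a1 < dist x a" using a1(2) unfolding s s1 by simp
    ultimately show ?thesis using less(1)[of a1 t] less(3-5) unfolding eq by blast
  qed
qed

text \<open>The distance equation places the crossing edge on a geodesic from \<open>u\<close> to
  \<open>y\<close>; \<open>S\<close> may be any set.\<close>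

lemma crossing_exists:
  assumes "u \<in> \<Union>C" "y \<in> \<Union>C" "u \<in> S" "y \<notin> S"
  shows "\<exists>x x'. is_edge C x x' \<and> x \<in> S \<and> x' \<notin> S \<and> Suc (dist u x + dist x' y) = dist u y"
  using assms
proof (induction "dist u y" arbitrary: u rule: less_induct)
  case less
  obtain u1 where u1: "is_edge C u u1" "dist u y = Suc (dist u1 y)" using dist_pred less by metis
  have v: "u1 \<in> \<Union>C" using is_edge_vertices[OF u1(1)] by simp
  show ?case
  proof (cases "u1 \<in> S")
    case False
    then show ?thesis using u1 less by (intro exI[of _ u] exI[of _ u1]) simp
  next
    case True
    then obtain x x' where x: "is_edge C x x'" "x \<in> S" "x' \<notin> S" "Suc (dist u1 x + dist x' y) = dist u1 y"
      using less(1)[of u1] u1 v less(3,5) by auto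
    have xv: "x \<in> \<Union>C" "x' \<in> \<Union>C" using is_edge_vertices[OF x(1)] by auto
    have "dist u x \<le> dist u u1 + dist u1 x" "dist u y \<le> dist u x + dist x y" "dist x y \<le> dist x x' + dist x' y"
      using dist_triangle less(2,3) v xv by auto
    then have "Suc (dist u x + dist x' y) = dist u y"
      using dist_edge[OF u1(1)] dist_edge[OF x(1)] u1(2) x(4) by linarith
    then show ?thesis using x by blast
  qed
qed

text \<open>A geodesic through an outside point would cross the same hyperplane at
  \<open>x x'\<close> and at \<open>z z'\<close>. Going straight from \<open>x\<close> to
  \<open>z\<close> takes at most as many steps as from \<open>x'\<close> to \<open>z'\<close>, so
  both crossings would be saved.\<close>

lemma halfspace_convex:
  assumes e: "is_edge C a b" and v: "v \<in> halfspace a b" and w: "w \<in> halfspace a b" and y: "y \<in> \<Union>C"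
    and d: "dist v y + dist y w = dist v w"
  shows "y \<in> halfspace a b"
proof (rule ccontr)
  assume ny: "y \<notin> halfspace a b"
  have V: "v \<in> \<Union>C" "w \<in> \<Union>C" using v w by (auto simp: halfspace_def)
  obtain x x' where x: "is_edge C x x'" "x \<in> halfspace a b" "x' \<notin> halfspace a b" "Suc (dist v x + dist x' y) = dist v y"
    using crossing_exists[OF V(1) y v ny] by blast
  obtain z z' where z: "is_edge C z z'" "z \<in> halfspace a b" "z' \<notin> halfspace a b" "Suc (dist w z + dist z' y) = dist w y"
    using crossing_exists[OF V(2) y w ny] by blast
  have xv: "x \<in> \<Union>C" "x' \<in> \<Union>C" "z \<in> \<Union>C" "z' \<in> \<Union>C"
    using is_edge_vertices[OF x(1)] is_edge_vertices[OF z(1)] by auto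
  have "halfspace z z' = halfspace a b" using halfspace_crossing e z by blast
  then have 1: "dist x z' = Suc (dist x z)" using halfspace_iff[OF z(1) xv(1)] x(2) by simp
  have "dist x z' \<le> dist x x' + dist x' z'" "dist x' z' \<le> dist x' y + dist y z'"
    "dist v w \<le> dist v x + dist x w" "dist x w \<le> dist x z + dist z w"
    using dist_triangle xv V y by auto
  moreover have "dist z w = dist w z" "dist y z' = dist z' y" "dist w y = dist y w"
    using dist_sym xv V y by auto
  ultimately show False using 1 x(4) z(4) d dist_edge[OF x(1)] by linarith
qed

section \<open>Separators and the vertices of the interval\<close>

definition separators :: "'v \<Rightarrow> 'v \<Rightarrow> 'v set set" where
  "separators v w = {halfspace a b | a b. is_edge C a b \<and> v \<in> halfspace a b \<and> w \<notin> halfspace a b}"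

text \<open>Each edge of a geodesic from \<open>v\<close> to \<open>w\<close> is crossed by only one
  separator.\<close>

lemma finite_separators:
  assumes "v \<in> \<Union>C" "w \<in> \<Union>C"
  shows "finite (separators v w)"
  using assms
proof (induction "dist v w" arbitrary: v)
  case 0
  then have "v = w" by (simp add: dist_eq_0D)
  then have "separators v w = {}" by (auto simp: separators_def)
  then show ?case by simp
next
  case (Suc n)
  have "v \<noteq> w" using Suc(2) dist_self[OF Suc(4)] by auto
  then obtain u where u: "is_edge C v u" "dist v w = Suc (dist u w)" using dist_pred Suc by metis
  have "u \<in> \<Union>C" using is_edge_vertices[OF u(1)] by simp
  then have "finite (separators u w)" using Suc u by simp
  moreover have "separators v w \<subseteq> insert (halfspace v u) (separators u w)"
  proof
    fix U assume "U \<in> separators v w"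
    then obtain a b where ab: "U = halfspace a b" "is_edge C a b" "v \<in> halfspace a b" "w \<notin> halfspace a b"
      by (auto simp: separators_def)
    show "U \<in> insert (halfspace v u) (separators u w)"
    proof (cases "u \<in> U")
      case True
      then show ?thesis using ab by (auto simp: separators_def)
    next
      case False
      then show ?thesis using halfspace_crossing[OF ab(2) u(1)] ab by simp
    qed
  qed
  ultimately show ?case by (meson finite_insert finite_subset)
qed

definition between :: "'v \<Rightarrow> 'v \<Rightarrow> 'v set" where
  "between v w = {x \<in> \<Union>C. dist v x + dist x w = dist v w}"

text \<open>The first edge of a geodesic from \<open>x\<close> to \<open>y\<close> bounds a
  halfspace that separates them. If it or its complement separates \<open>v\<close> from
  \<open>w\<close>, the hypothesis fails; otherwise \<open>v\<close> and \<open>w\<close> lie on one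
  side, and by convexity so do both \<open>x\<close> and \<open>y\<close>.\<close>

lemma sep_determines_vertex:
  assumes V: "v \<in> \<Union>C" "w \<in> \<Union>C" and x: "x \<in> between v w" and y: "y \<in> between v w"
    and eq: "{U \<in> separators v w. x \<notin> U} = {U \<in> separators v w. y \<notin> U}"
  shows "x = y"
proof (rule ccontr)
  assume "x \<noteq> y"
  have xv: "x \<in> \<Union>C" "y \<in> \<Union>C" using x y by (auto simp: between_def)
  obtain x1 where x1: "is_edge C x x1" "dist x y = Suc (dist x1 y)"
    using dist_pred xv \<open>x \<noteq> y\<close> by metis
  have x1v: "x1 \<in> \<Union>C" using is_edge_vertices[OF x1(1)] by simp
  have xW: "x \<in> halfspace x x1" using halfspace_ends[OF x1(1)] by simp
  have yW: "y \<notin> halfspace x x1"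
    using x1(2) dist_sym[OF xv] dist_sym[OF x1v xv(2)] not_halfspace_iff[OF x1(1) xv(2)] by simp
  note e' = is_edge_sym[OF x1(1)]
  note f = halfspace_flip[OF x1(1)]
  consider "v \<in> halfspace x x1" "w \<notin> halfspace x x1" | "v \<notin> halfspace x x1" "w \<in> halfspace x x1"
    | "v \<in> halfspace x x1" "w \<in> halfspace x x1" | "v \<notin> halfspace x x1" "w \<notin> halfspace x x1" by blast
  then show False
  proof cases
    case 1
    then have "halfspace x x1 \<in> separators v w" using x1(1) by (auto simp: separators_def)
    then show False using eq xW yW by blast
  next
    case 2
    then have "halfspace x1 x \<in> separators v w" using e' f V by (auto simp: separators_def)
    moreover have "x \<notin> halfspace x1 x" "y \<in> halfspace x1 x" using f xW yW xv by auto
    ultimately show False using eq by blast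
  next
    case 3
    then show False using halfspace_convex[OF x1(1) 3 xv(2)] yW y by (simp add: between_def)
  next
    case 4
    then have "v \<in> halfspace x1 x" "w \<in> halfspace x1 x" using f V by auto
    then have "x \<in> halfspace x1 x" using halfspace_convex[OF e', of v w x] xv(1) x by (simp add: between_def)
    then show False using f xW xv by simp
  qed
qed

lemma between_step:
  assumes V: "v \<in> \<Union>C" "w \<in> \<Union>C" and x: "x \<in> between v w" and e: "is_edge C x x'"
    and h: "v \<in> halfspace x x'" "w \<notin> halfspace x x'"
  shows "x' \<in> between v w" "dist v x' = Suc (dist v x)"
proof -
  have xv: "x \<in> \<Union>C" "x' \<in> \<Union>C" using is_edge_vertices[OF e] by auto
  show 1: "dist v x' = Suc (dist v x)" using halfspace_iff[OF e V(1)] h by simp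
  have "dist w x = Suc (dist w x')" using not_halfspace_iff[OF e V(2)] h by simp
  then have "dist x w = Suc (dist x' w)" using dist_sym V xv by simp
  then show "x' \<in> between v w" using 1 x xv by (simp add: between_def)
qed

lemma between_edge_sep:
  assumes V: "v \<in> \<Union>C" "w \<in> \<Union>C" and x: "x \<in> between v w" "x' \<in> between v w" and e: "is_edge C x x'"
    and h: "v \<in> halfspace x x'"
  shows "w \<notin> halfspace x x'"
proof
  assume "w \<in> halfspace x x'"
  then have "dist w x' = Suc (dist w x)" "dist v x' = Suc (dist v x)"
    using halfspace_iff[OF e] V h by simp_all
  moreover have "dist w x = dist x w" "dist w x' = dist x' w"
    using dist_sym V is_edge_vertices[OF e] by auto
  ultimately show False using x by (simp add: between_def)
qed

text \<open>A geodesic from \<open>x\<close> to \<open>w\<close> leaves \<open>U\<close> along some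
  edge \<open>z z'\<close>. While \<open>z\<close> is not \<open>x\<close>, minimality lets this
  edge slide across a square one step towards \<open>x\<close>, staying on a geodesic to
  \<open>w\<close>.\<close>

lemma minimal_sep_edge:
  assumes V: "v \<in> \<Union>C" "w \<in> \<Union>C" and U: "U \<in> separators v w" and x: "x \<in> between v w" "x \<in> U"
    and min: "\<And>U'. U' \<in> separators v w \<Longrightarrow> x \<in> U' \<Longrightarrow> U' \<subseteq> U \<Longrightarrow> U' = U"
  shows "\<exists>x'. is_edge C x x' \<and> halfspace x x' = U"
proof -
  have xv: "x \<in> \<Union>C" using x by (simp add: between_def)
  have move: "\<exists>x'. is_edge C x x' \<and> halfspace x x' = U"
    if "is_edge C z z'" "halfspace z z' = U" "Suc (dist x z + dist z' w) = dist x w" for z z'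
    using that
  proof (induction "dist x z" arbitrary: z z' rule: less_induct)
    case less
    have zv: "z \<in> \<Union>C" "z' \<in> \<Union>C" using is_edge_vertices[OF less(2)] by auto
    show ?case
    proof (cases "z = x")
      case True
      then show ?thesis using less by blast
    next
      case False
      then obtain z0 where z0: "is_edge C z z0" "dist z x = Suc (dist z0 x)"
        using dist_pred zv xv by metis
      have z0v: "z0 \<in> \<Union>C" using is_edge_vertices[OF z0(1)] by simp
      note e0 = is_edge_sym[OF z0(1)]
      have s: "dist z x = dist x z" "dist z0 x = dist x z0" "dist w z = dist z w" "dist w z0 = dist z0 w"
        using dist_sym zv z0v xv V by auto
      have dx: "dist x z = Suc (dist x z0)" using z0(2) unfolding s .
      have "dist x w \<le> dist x z0 + dist z0 w" "dist z w \<le> dist z z' + dist z' w"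
        using dist_triangle xv zv z0v V by auto
      then have "dist z w < dist z0 w" using dx less(4) dist_edge[OF less(2)] by linarith
      then have wW: "w \<notin> halfspace z0 z" unfolding halfspace_def s[symmetric] by simp
      have "dist v w \<le> dist v z + dist z w" "dist v z0 \<le> dist v x + dist x z0"
        "dist v x + dist x w = dist v w" "dist z w \<le> dist z z' + dist z' w"
        using dist_triangle xv zv z0v V x(1) by (auto simp: between_def)
      then have "dist v z0 < dist v z" using dx less(4) dist_edge[OF less(2)] by linarith
      then have vW: "v \<in> halfspace z0 z" using V by (simp add: halfspace_def)
      have xW: "x \<in> halfspace z0 z" using dx xv by (simp add: halfspace_def)
      have "halfspace z0 z \<in> separators v w" using e0 vW wW by (auto simp: separators_def)
      moreover have "halfspace z0 z \<noteq> U" using halfspace_ends[OF e0] halfspace_ends[OF less(2)] less(3) by auto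
      \<comment> \<open>This yields a point \<open>q\<close> from which both \<open>z0\<close> and
        \<open>z'\<close> are nearer than \<open>z\<close>, the situation of
        \<open>quadrangle\<close>.\<close>
      ultimately have "\<not> halfspace z0 z \<subseteq> U" using min xW by blast
      then obtain q where q: "q \<in> halfspace z0 z" "q \<notin> U" by blast
      have qv: "q \<in> \<Union>C" using q by (simp add: halfspace_def)
      have q0: "dist q z = Suc (dist q z0)" using q(1) halfspace_iff[OF e0 qv] by simp
      have q1: "dist q z = Suc (dist q z')" using q(2) not_halfspace_iff[OF less(2) qv] less(3) by simp
      have ne: "z0 \<noteq> z'"
      proof
        assume "z0 = z'"
        then show False using \<open>dist z w < dist z0 w\<close> less(4) dx
            dist_triangle[OF xv z0v V(2)] by simp
      qed
      obtain t where t: "sq C z z0 t z'" using quadrangle[OF qv z0(1) less(2) ne q0 q1] by blast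
      have "halfspace z0 t = U" using halfspace_sq[OF sq_rotate_back[OF t]] less(3) halfspace_sq[OF sq_flip[OF t]] by simp
      moreover have et: "is_edge C z0 t" "is_edge C t z'" using sq_edges[OF t] by auto
      moreover have tv: "t \<in> \<Union>C" using is_edge_vertices[OF et(1)] by simp
      have "dist t w \<le> dist t z' + dist z' w" "dist x w \<le> dist x z0 + dist z0 w" "dist z0 w \<le> dist z0 t + dist t w"
        using dist_triangle tv xv zv z0v V by auto
      then have "Suc (dist x z0 + dist t w) = dist x w"
        using dist_edge[OF et(1)] dist_edge[OF et(2)] dx less(4) by linarith
      ultimately show ?thesis using less(1)[of z0 t] dx by simp
    qed
  qed
  obtain a b where ab: "U = halfspace a b" "is_edge C a b" "w \<notin> U" using U by (auto simp: separators_def)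
  obtain z z' where z: "is_edge C z z'" "z \<in> U" "z' \<notin> U" "Suc (dist x z + dist z' w) = dist x w"
    using crossing_exists[OF xv V(2) x(2) ab(3)] by blast
  have "halfspace z z' = U" using halfspace_crossing[OF ab(2) z(1)] z ab(1) by simp
  then show ?thesis using move z by blast
qed

section \<open>Cubes in intervals and coordinates\<close>

lemma geodesic_vertex_iff:
  assumes V: "v \<in> \<Union>C" "w \<in> \<Union>C"
  shows "(\<exists>p. edge_geodesic C v w p \<and> u \<in> set p) \<longleftrightarrow> u \<in> between v w"
proof
  assume "\<exists>p. edge_geodesic C v w p \<and> u \<in> set p"
  then obtain p where p: "walk C p" "hd p = v" "last p = w" "u \<in> set p"
    and min: "\<And>q. walk C q \<Longrightarrow> hd q = v \<Longrightarrow> last q = w \<Longrightarrow> length p \<le> length q"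
    by (auto simp: edge_geodesic_def)
  obtain q where "walk C q" "hd q = v" "last q = w" "length q = Suc (dist v w)"
    using dist_walk[OF V] by blast
  then have len: "length p \<le> Suc (dist v w)" using min by metis
  obtain l r where lr: "p = l @ u # r" using p(4) by (meson split_list)
  have u: "u \<in> \<Union>C" using p(1,4) by (auto simp: walk_def)
  have ur: "walk C (u # r)" using p(1) lr by (cases "l = []") (auto simp: walk_append)
  have "last (u # r) = w" using p(3) lr by simp
  then have 1: "dist u w \<le> length r" using dist_le[OF ur, of u w] by simp
  have lu: "walk C (l @ [u])"
    using p(1) u unfolding lr by (cases "l = []") (auto simp: walk_append)
  have "hd (l @ [u]) = v" using p(2) lr by (cases l) auto
  then have 2: "dist v u \<le> length l" using dist_le[OF lu, of v u] by simp
  have "dist v u + dist u w \<le> dist v w" using 1 2 len lr by simp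
  then show "u \<in> between v w" using dist_triangle[OF V(1) u V(2)] u by (simp add: between_def)
next
  assume "u \<in> between v w"
  then have u: "u \<in> \<Union>C" "dist v u + dist u w = dist v w" by (auto simp: between_def)
  obtain p where p: "walk C p" "hd p = v" "last p = u" "length p = Suc (dist v u)"
    using dist_walk[OF V(1) u(1)] by blast
  obtain q where q: "walk C q" "hd q = u" "last q = w" "length q = Suc (dist u w)"
    using dist_walk[OF u(1) V(2)] by blast
  have pq: "walk C (p @ tl q)" "hd (p @ tl q) = v" "last (p @ tl q) = w"
    using walk_concat[OF p(1) q(1)] p q by simp_all
  have len: "length (p @ tl q) = Suc (dist v w)" using p q u by simp
  have "length (p @ tl q) \<le> length r" if "walk C r" "hd r = v" "last r = w" for r
    using dist_le[OF that] len by simp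
  then have "edge_geodesic C v w (p @ tl q)" using pq by (simp add: edge_geodesic_def)
  moreover have "u \<in> set (p @ tl q)" using p(1,3) last_in_set[of p] by (auto simp: walk_def)
  ultimately show "\<exists>p. edge_geodesic C v w p \<and> u \<in> set p" by blast
qed

lemma interval_eq:
  "v \<in> \<Union>C \<Longrightarrow> w \<in> \<Union>C \<Longrightarrow> interval C v w = {Q \<in> C. Q \<subseteq> between v w}"
  unfolding interval_def using geodesic_vertex_iff[of v w] by blast

section \<open>Halfspaces dual to the directions of a cube\<close>

lemma chart_label:
  assumes g: "chart_at C Q I g u" and S: "S \<subseteq> I" and i: "i \<in> I - S"
  shows "halfspace (g S) (g (insert i S)) = halfspace u (g {i})"
proof -
  have "finite S" using g S by (auto simp: chart_at_def intro: finite_subset)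
  then show ?thesis using S i
  proof (induction S rule: finite_induct)
    case empty
    then show ?case using g by (simp add: chart_at_def)
  next
    case (insert j S)
    have "sq C (g S) (g (insert i S)) (g (insert i (insert j S))) (g (insert j S))"
      using insert by (intro chart_at_sq[OF g]) auto
    from halfspace_sq[OF this] show ?case using insert by auto
  qed
qed

lemma chart_mem_label:
  assumes g: "chart_at C Q I g u" and S: "S \<subseteq> I" and i: "i \<in> I"
  shows "g S \<in> halfspace u (g {i}) \<longleftrightarrow> i \<notin> S"
proof (cases "i \<in> S")
  case True
  have S': "S - {i} \<subseteq> I" "i \<in> I - (S - {i})" using S i by auto
  have "insert i (S - {i}) = S" using True by auto
  then have "g S \<notin> halfspace (g (S - {i})) (g (insert i (S - {i})))"
    using halfspace_ends(2)[OF chart_at_edge[OF g S']] by simp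
  then show ?thesis using True chart_label[OF g S'] by simp
next
  case False
  then have S': "i \<in> I - S" using i by simp
  then show ?thesis using halfspace_ends(1)[OF chart_at_edge[OF g S S']] chart_label[OF g S S'] False by simp
qed

text \<open>The vertex \<open>g {j}\<close> has left the halfspace of direction \<open>j\<close> but
  not that of any other direction. Hence different directions will fall into different
  chains.\<close>

lemma chart_label_subset:
  assumes g: "chart_at C Q I g u" and ij: "i \<in> I" "j \<in> I" and sub: "halfspace u (g {i}) \<subseteq> halfspace u (g {j})"
  shows "i = j"
proof (rule ccontr)
  assume "i \<noteq> j"
  then have "g {j} \<in> halfspace u (g {i})" using chart_mem_label[OF g, of "{j}" i] ij by simp
  then show False using sub chart_mem_label[OF g, of "{j}" j] ij by auto
qed

lemma antichain_cube:
  assumes V: "v \<in> \<Union>C" "w \<in> \<Union>C" and A: "A \<subseteq> separators v w" "antichain A"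
  shows "\<exists>Q\<in>C. Q \<subseteq> between v w \<and> card Q = 2 ^ card A"
proof -
  have finA: "finite A" using A(1) finite_separators[OF V] finite_subset by blast
  txt \<open>At a vertex of the interval as far from \<open>v\<close> as possible among those lying in all members of
    \<open>A\<close>, every member of \<open>A\<close> is the halfspace of an outgoing edge, and these edges span the cube.\<close>
  let ?P = "\<lambda>x. x \<in> between v w \<and> (\<forall>U\<in>A. x \<in> U)"
  have "?P v" using V A(1) by (auto simp: between_def separators_def)
  moreover have "\<forall>y. ?P y \<longrightarrow> dist v y < Suc (dist v w)" by (auto simp: between_def)
  ultimately have "\<exists>x. ?P x \<and> (\<forall>y. ?P y \<longrightarrow> dist v y \<le> dist v x)"
    by (rule ex_has_greatest_nat)
  then obtain x where x: "x \<in> between v w" "\<And>U. U \<in> A \<Longrightarrow> x \<in> U"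
    and max: "\<And>y. ?P y \<Longrightarrow> dist v y \<le> dist v x" by blast
  have xv: "x \<in> \<Union>C" using x(1) by (simp add: between_def)
  have "\<exists>x'. is_edge C x x' \<and> halfspace x x' = U" if U: "U \<in> A" for U
  proof -
    \<comment> \<open>\<open>minimal_sep_edge\<close> needs a minimal separator, so it is applied to
      some \<open>U0\<close> below \<open>U\<close>; the choice of \<open>x\<close> then forces
      \<open>U0 = U\<close>.\<close>
    let ?T = "{U' \<in> separators v w. x \<in> U' \<and> U' \<subseteq> U}"
    have "finite ?T" "?T \<noteq> {}" using finite_separators[OF V] U A(1) x(2) by auto
    from finite_has_minimal[OF this] obtain U0 where
      "U0 \<in> ?T" and min: "\<forall>U'\<in>?T. U' \<subseteq> U0 \<longrightarrow> U0 = U'"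
      by (rule bexE)
    then have U0: "U0 \<in> separators v w" "x \<in> U0" "U0 \<subseteq> U" by simp_all
    have "U' = U0" if "U' \<in> separators v w" "x \<in> U'" "U' \<subseteq> U0" for U'
      using min[rule_format, of U'] that subset_trans[OF that(3) U0(3)] by simp
    then obtain x' where x': "is_edge C x x'" "halfspace x x' = U0"
      using minimal_sep_edge[OF V U0(1) x(1) U0(2)] by blast
    show ?thesis
    proof (cases "U0 = U")
      case True
      then show ?thesis using x' by blast
    next
      case False
      \<comment> \<open>Crossing \<open>U0\<close> moves away from \<open>v\<close> inside the
        interval. A member of \<open>A\<close> left by this step equals \<open>U0\<close>, so it is
        contained in \<open>U\<close>, and incomparability makes it \<open>U\<close>.\<close>
      have vw: "v \<in> halfspace x x'" "w \<notin> halfspace x x'" using U0(1) x'(2) by (auto simp: separators_def)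
      have "x' \<in> U2" if U2: "U2 \<in> A" for U2
      proof (rule ccontr)
        assume n: "x' \<notin> U2"
        obtain a b where ab: "U2 = halfspace a b" "is_edge C a b" using U2 A(1) by (auto simp: separators_def)
        then have "U2 = U0" using halfspace_crossing[OF ab(2) x'(1)] x(2)[OF U2] n x'(2) by simp
        then have "U2 = U" using A(2) U U2 U0(3) unfolding antichain_def by blast
        then show False using False \<open>U2 = U0\<close> by simp
      qed
      then have "dist v x' \<le> dist v x" using max between_step(1)[OF V x(1) x'(1) vw] by blast
      then show ?thesis using between_step(2)[OF V x(1) x'(1) vw] by simp
    qed
  qed
  then have "\<forall>U\<in>A. \<exists>x'. is_edge C x x' \<and> halfspace x x' = U" by blast
  from bchoice[OF this] obtain f where f: "\<And>U. U \<in> A \<Longrightarrow> is_edge C x (f U)" "\<And>U. U \<in> A \<Longrightarrow> halfspace x (f U) = U"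
    by blast
  have injf: "inj_on f A" by (rule inj_onI) (metis f(2))
  let ?N = "f ` A"
  \<comment> \<open>All these edges lead towards \<open>w\<close>, so any two span a square by the
    quadrangle condition based at \<open>w\<close>; the flag condition then fills in the
    cube.\<close>
  have "\<exists>Q\<in>C. card Q = 4 \<and> {x, a, b} \<subseteq> Q" if ab: "a \<in> ?N" "b \<in> ?N" "a \<noteq> b" for a b
  proof -
    have d: "is_edge C x c \<and> dist w x = Suc (dist w c)" if c: "c \<in> ?N" for c
    proof -
      obtain U where U: "U \<in> A" "c = f U" using c by blast
      then have "w \<notin> halfspace x c" using f(2) A(1) by (auto simp: separators_def)
      then show ?thesis using f(1) U not_halfspace_iff V(2) by simp
    qed
    obtain t where t: "sq C x a t b"
      using quadrangle[OF V(2) conjunct1[OF d[OF ab(1)]] conjunct1[OF d[OF ab(2)]] ab(3)]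
        d[OF ab(1)] d[OF ab(2)] by blast
    then show ?thesis unfolding sq_def by (intro bexI[of _ "{x, a, t, b}"]) auto
  qed
  then obtain Q where Q: "Q \<in> C" "card Q = 2 ^ card ?N" "insert x ?N \<subseteq> Q"
    using flag[OF xv, of ?N] finA f(1) by blast
  have cN: "card ?N = card A" using injf by (rule card_image)
  obtain I g where g: "chart_at C Q I g x" using chart_at_exists[OF Q(1)] Q(3) by blast
  have finI: "finite I" using g by (simp add: chart_at_def)
  \<comment> \<open>\<open>Q\<close> has exactly \<open>card A\<close> directions, so the chosen
    edges are all its edges at \<open>x\<close> and every direction is dual to a separator; hence
    \<open>Q\<close> stays in the interval.\<close>
  have "card I = card A" using chart_at_card[OF g] Q(2) cN by simp
  have "?N \<subseteq> (\<lambda>i. g {i}) ` I"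
  proof
    fix y assume "y \<in> ?N"
    then have "is_edge C x y" "y \<in> Q" using f(1) Q(3) by auto
    then show "y \<in> (\<lambda>i. g {i}) ` I" using chart_at_nbr[OF g] by blast
  qed
  moreover have "card ((\<lambda>i. g {i}) ` I) \<le> card ?N"
    using card_image_le[OF finI] \<open>card I = card A\<close> cN by metis
  ultimately have N: "?N = (\<lambda>i. g {i}) ` I" using finI by (intro card_seteq) auto
  have lab: "halfspace x (g {i}) \<in> separators v w" if i: "i \<in> I" for i
  proof -
    have "g {i} \<in> ?N" using N i by blast
    then obtain U where "U \<in> A" "g {i} = f U" by blast
    then show ?thesis using f(2) A(1) by auto
  qed
  have "g S \<in> between v w" if S: "S \<subseteq> I" for S
  proof -
    have "finite S" using S finI finite_subset by blast
    then show ?thesis using S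
    proof (induction S rule: finite_induct)
      case empty
      then show ?case using g x(1) by (simp add: chart_at_def)
    next
      case (insert i S)
      then have i: "S \<subseteq> I" "i \<in> I - S" by auto
      have "v \<in> halfspace x (g {i})" "w \<notin> halfspace x (g {i})" using lab i by (auto simp: separators_def)
      then show ?case
        using between_step(1)[OF V _ chart_at_edge[OF g i]] insert.IH[OF i(1)] chart_label[OF g i] by simp
    qed
  qed
  moreover have "Q = g ` Pow I" using g by (simp add: chart_at_def bij_betw_def)
  ultimately have "Q \<subseteq> between v w" by auto
  then show ?thesis using Q cN by auto
qed

text \<open>Centring at the vertex of \<open>Q\<close> nearest to \<open>v\<close> makes every edge
  at the centre lead away from \<open>v\<close>, and so towards \<open>w\<close>.\<close>

lemma interval_chart:
  assumes V: "v \<in> \<Union>C" "w \<in> \<Union>C" and Q: "Q \<in> C" "Q \<subseteq> between v w"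
  shows "\<exists>I g u. chart_at C Q I g u \<and> (\<forall>i\<in>I. halfspace u (g {i}) \<in> separators v w)"
proof -
  have "Q \<noteq> {}" using cc Q(1) by (auto simp: cube_complex_def)
  then obtain u where u: "u \<in> Q" "\<And>y. y \<in> Q \<Longrightarrow> dist v u \<le> dist v y"
    using ex_has_least_nat[of "\<lambda>y. y \<in> Q" _ "dist v"] by blast
  then obtain I g where g: "chart_at C Q I g u" using chart_at_exists[OF Q(1)] by blast
  have "halfspace u (g {i}) \<in> separators v w" if i: "i \<in> I" for i
  proof -
    have e: "is_edge C u (g {i})"
      using chart_at_edge[OF g, of "{}" i] i g by (simp add: chart_at_def)
    have gi: "g {i} \<in> Q" using g i by (auto simp: chart_at_def bij_betw_def)
    have "dist v (g {i}) = Suc (dist v u)" using dist_edge_cases[OF e V(1)] u(2)[OF gi] by auto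
    then have v: "v \<in> halfspace u (g {i})" using halfspace_iff[OF e V(1)] by simp
    then have "w \<notin> halfspace u (g {i})" using between_edge_sep[OF V _ _ e] u(1) gi Q(2) by blast
    then show ?thesis using e v by (auto simp: separators_def)
  qed
  then show ?thesis using g by blast
qed

text \<open>Adding the directions of \<open>S\<close> one at a time crosses only the hyperplanes
  dual to them, each outwards from \<open>v\<close>, so no separator is re-entered.\<close>

lemma chart_separators:
  assumes g: "chart_at C Q I g u" and lab: "\<And>i. i \<in> I \<Longrightarrow> halfspace u (g {i}) \<in> separators v w"
    and V: "v \<in> \<Union>C" and S: "S \<subseteq> I" and U: "U \<in> separators v w"
  shows "g S \<notin> U \<longleftrightarrow> u \<notin> U \<or> (\<exists>i\<in>S. U = halfspace u (g {i}))"
proof -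
  have g0: "g {} = u" using g by (simp add: chart_at_def)
  show ?thesis
  proof (cases "\<exists>i\<in>S. U = halfspace u (g {i})")
    case True
    then obtain i where "i \<in> S" "U = halfspace u (g {i})" by blast
    then show ?thesis using chart_mem_label[OF g S, of i] S by auto
  next
    case False
    obtain a b where ab: "U = halfspace a b" "is_edge C a b" "v \<in> U" using U by (auto simp: separators_def)
    have "finite S" using g S by (auto simp: chart_at_def intro: finite_subset)
    then have "g S \<in> U \<longleftrightarrow> u \<in> U" using S False
    proof (induction S rule: finite_induct)
      case empty
      then show ?case using g0 by simp
    next
      case (insert i S)
      then have i: "S \<subseteq> I" "i \<in> I - S" by auto
      note e = chart_at_edge[OF g i]
      have L: "halfspace (g S) (g (insert i S)) = halfspace u (g {i})" by (rule chart_label[OF g i])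
      have "v \<in> halfspace u (g {i})" using lab i by (auto simp: separators_def)
      then have "v \<notin> halfspace (g (insert i S)) (g S)" using halfspace_flip[OF e V] L by simp
      then have "\<not> (g S \<notin> U \<and> g (insert i S) \<in> U)"
        using halfspace_crossing[OF ab(2) is_edge_sym[OF e]] ab by auto
      moreover have "\<not> (g S \<in> U \<and> g (insert i S) \<notin> U)"
        using halfspace_crossing[OF ab(2) e] ab(1) L insert.prems(2) by auto
      ultimately show ?case using insert.IH[OF i(1)] insert.prems(2) by auto
    qed
    then show ?thesis using False by simp
  qed
qed

section \<open>The coordinate map on the interval\<close>

definition coords :: "('v set \<Rightarrow> nat) \<Rightarrow> 'v \<Rightarrow> 'v \<Rightarrow> 'v \<Rightarrow> nat \<Rightarrow> int" where
  "coords c v w x j = int (card {U \<in> separators v w. x \<notin> U \<and> c U = j})"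

text \<open>Within a chain the separators missing \<open>x\<close> and those missing
  \<open>y\<close> are both initial segments, hence nested, and equal counts make them
  equal.\<close>

lemma coords_inj:
  assumes V: "v \<in> \<Union>C" "w \<in> \<Union>C" and c: "chain_cover c (separators v w) n"
  shows "inj_on (coords c v w) (between v w)"
proof (rule inj_onI)
  fix x y assume xy: "x \<in> between v w" "y \<in> between v w" and eq: "coords c v w x = coords c v w y"
  let ?D = "\<lambda>x j. {U \<in> separators v w. x \<notin> U \<and> c U = j}"
  have fin: "finite (?D z j)" for z j using finite_separators[OF V] by simp
  have "?D x j = ?D y j" for j
  proof -
    have eqc: "card (?D x j) = card (?D y j)" using fun_cong[OF eq, of j] by (simp add: coords_def)
    have "?D x j \<subseteq> ?D y j \<or> ?D y j \<subseteq> ?D x j"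
      using c unfolding chain_cover_def by (smt (verit) mem_Collect_eq subset_iff)
    then show ?thesis
      using card_subset_eq[OF fin _ eqc] card_subset_eq[OF fin _ eqc[symmetric]] by (elim disjE) simp_all
  qed
  then have "{U \<in> separators v w. x \<notin> U} = {U \<in> separators v w. y \<notin> U}" by blast
  then show "x = y" by (rule sep_determines_vertex[OF V xy])
qed

text \<open>Direction \<open>i\<close> adds one missed separator, in chain \<open>k i\<close>.
  Distinct directions are incomparable, so no coordinate is raised twice.\<close>

lemma coords_chart:
  assumes V: "v \<in> \<Union>C" "w \<in> \<Union>C" and c: "chain_cover c (separators v w) n"
    and g: "chart_at C Q I g u" and lab: "\<And>i. i \<in> I \<Longrightarrow> halfspace u (g {i}) \<in> separators v w"
  shows "inj_on (\<lambda>i. c (halfspace u (g {i}))) I" (is "inj_on ?k I")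
    and "S \<subseteq> I \<Longrightarrow> coords c v w (g S) =
      (\<lambda>j. coords c v w u j + (if j \<in> (\<lambda>i. c (halfspace u (g {i}))) ` S then 1 else 0))"
proof -
  show inj: "inj_on ?k I"
    using c lab chart_label_subset[OF g] unfolding inj_on_def chain_cover_def by metis
  assume S: "S \<subseteq> I"
  show "coords c v w (g S) = (\<lambda>j. coords c v w u j + (if j \<in> ?k ` S then 1 else 0))"
  proof
    fix j
    let ?D = "\<lambda>x. {U \<in> separators v w. x \<notin> U \<and> c U = j}"
    let ?E = "(\<lambda>i. halfspace u (g {i})) ` {i \<in> S. ?k i = j}"
    have "?D (g S) = ?D u \<union> ?E"
      using chart_separators[OF g lab V(1) S] lab S by auto
    moreover have "?D u \<inter> ?E = {}"
      using chart_mem_label[OF g, of "{}"] g S by (auto simp: chart_at_def)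
    moreover have "finite (?D u)" using finite_separators[OF V] by simp
    moreover have "finite ?E" using g S by (auto simp: chart_at_def intro: finite_subset)
    ultimately have "card (?D (g S)) = card (?D u) + card ?E" by (simp add: card_Un_disjoint)
    moreover have "card ?E = (if j \<in> ?k ` S then 1 else 0)"
    proof (cases "j \<in> ?k ` S")
      case True
      then obtain i where i: "i \<in> S" "?k i = j" by blast
      then have "{i \<in> S. ?k i = j} = {i}" using inj S by (auto simp: inj_on_def)
      then show ?thesis using True by simp
    next
      case False
      then have "?E = {}" by auto
      then show ?thesis using False by (simp only: card.empty if_False)
    qed
    ultimately show "coords c v w (g S) j = coords c v w u j + (if j \<in> ?k ` S then 1 else 0)"
      by (simp add: coords_def)
  qed
qed

lemma coords_cube_image:
  assumes V: "v \<in> \<Union>C" "w \<in> \<Union>C" and c: "chain_cover c (separators v w) n"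
    and Q: "Q \<in> C" "Q \<subseteq> between v w"
  shows "lattice_cube n (coords c v w ` Q)"
    and "lattice_cube n P \<Longrightarrow> P \<subseteq> coords c v w ` Q \<Longrightarrow> \<exists>F\<in>C. F \<subseteq> Q \<and> P = coords c v w ` F"
proof -
  obtain I g u where g: "chart_at C Q I g u" and lab: "\<And>i. i \<in> I \<Longrightarrow> halfspace u (g {i}) \<in> separators v w"
    using interval_chart[OF V Q] by blast
  define k where "k i = c (halfspace u (g {i}))" for i
  have inj: "inj_on k I" using coords_chart(1)[OF V c g lab] by (simp add: k_def[abs_def])
  have co: "coords c v w (g S) = (\<lambda>j. coords c v w u j + (if j \<in> k ` S then 1 else 0))"
    if "S \<subseteq> I" for S
    using coords_chart(2)[OF V c g lab that] by (simp add: k_def[abs_def])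
  have Qg: "Q = g ` Pow I" using g by (simp add: chart_at_def bij_betw_def)
  have "coords c v w ` Q = {(\<lambda>j. coords c v w u j + (if j \<in> S then 1 else 0)) | S. S \<subseteq> k ` I}"
    (is "_ = ?R")
  proof
    show "coords c v w ` Q \<subseteq> ?R" unfolding Qg using co by (auto intro: image_mono)
    show "?R \<subseteq> coords c v w ` Q"
    proof
      fix z assume "z \<in> ?R"
      then obtain S where S: "S \<subseteq> k ` I" "z = (\<lambda>j. coords c v w u j + (if j \<in> S then 1 else 0))" by blast
      then obtain T where "T \<subseteq> I" "S = k ` T" by (meson subset_imageE)
      then have "z = coords c v w (g T)" using S co by simp
      then show "z \<in> coords c v w ` Q" unfolding Qg using \<open>T \<subseteq> I\<close> by blast
    qed
  qed
  moreover have "k ` I \<subseteq> {..<n}" using c lab by (auto simp: k_def chain_cover_def)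
  moreover have "\<forall>i\<ge>n. coords c v w u i = 0"
  proof (intro allI impI)
    fix i assume "i \<ge> n"
    then have "{U \<in> separators v w. u \<notin> U \<and> c U = i} = {}" using c by (auto simp: chain_cover_def)
    then show "coords c v w u i = 0" by (simp only: coords_def card.empty of_nat_0)
  qed
  ultimately show "lattice_cube n (coords c v w ` Q)" unfolding lattice_cube_def by blast
  assume P: "lattice_cube n P" "P \<subseteq> coords c v w ` Q"
  obtain y J where y: "P = {(\<lambda>j. y j + (if j \<in> S then 1 else 0)) | S. S \<subseteq> J}"
    using P(1) by (auto simp: lattice_cube_def)
  have inQ: "\<exists>B\<subseteq>I. (\<lambda>j. y j + (if j \<in> S then 1 else 0)) = coords c v w (g B)" if "S \<subseteq> J" for S
  proof -
    have "(\<lambda>j. y j + (if j \<in> S then 1 else 0)) \<in> P" unfolding y using that by blast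
    then show ?thesis using P(2) unfolding Qg by auto
  qed
  obtain A where A: "A \<subseteq> I" "y = coords c v w (g A)" using inQ[of "{}"] by auto
  \<comment> \<open>Both \<open>y\<close> and its neighbour in direction \<open>j\<close> are images
    of vertices of \<open>Q\<close>, whose \<open>j\<close>-th coordinates exceed that of
    \<open>u\<close> by 0 or 1. So \<open>j\<close> belongs to a direction of \<open>Q\<close> in
    which \<open>A\<close> has not yet moved.\<close>
  have J: "j \<in> k ` I \<and> j \<notin> k ` A" if "j \<in> J" for j
  proof -
    obtain B where B: "B \<subseteq> I" "(\<lambda>i. y i + (if i \<in> {j} then 1 else 0)) = coords c v w (g B)"
      using inQ[of "{j}"] \<open>j \<in> J\<close> by blast
    have "y j + 1 = coords c v w (g B) j" using fun_cong[OF B(2), of j] by simp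
    then have "(if j \<in> k ` A then 1 else 0) + 1 = (if j \<in> k ` B then 1 else (0::int))"
      using co[OF A(1)] co[OF B(1)] A(2) by simp
    then have "j \<in> k ` B" "j \<notin> k ` A" by (auto split: if_splits)
    then show ?thesis using B(1) by blast
  qed
  define J' where "J' = {i \<in> I. k i \<in> J}"
  have kJ: "k ` J' = J" using J by (auto simp: J'_def)
  have AJ: "A \<subseteq> I - J'" using A(1) J by (auto simp: J'_def)
  have face: "coords c v w (g (A \<union> S)) = (\<lambda>j. y j + (if j \<in> k ` S then 1 else 0))" if "S \<subseteq> J'" for S
  proof -
    have "k ` S \<inter> k ` A = {}" using that J by (auto simp: J'_def)
    moreover have "A \<union> S \<subseteq> I" using that A(1) by (auto simp: J'_def)
    ultimately show ?thesis using co[of "A \<union> S"] co[OF A(1)] A(2) by (auto simp: fun_eq_iff image_Un)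
  qed
  let ?F = "cube_face g J' A"
  have "P = coords c v w ` ?F"
  proof
    show "P \<subseteq> coords c v w ` ?F"
    proof
      fix z assume "z \<in> P"
      then obtain S where S: "S \<subseteq> J" "z = (\<lambda>j. y j + (if j \<in> S then 1 else 0))" unfolding y by blast
      then obtain T where T: "T \<subseteq> J'" "S = k ` T" using kJ by (metis subset_imageE)
      then have "z = coords c v w (g (A \<union> T))" using S face by simp
      then show "z \<in> coords c v w ` ?F" using T(1) by (auto simp: cube_face_def)
    qed
    show "coords c v w ` ?F \<subseteq> P"
    proof
      fix z assume "z \<in> coords c v w ` ?F"
      then obtain T where T: "T \<subseteq> J'" "z = coords c v w (g (A \<union> T))" by (auto simp: cube_face_def)
      moreover have "k ` T \<subseteq> J" using T(1) kJ by blast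
      ultimately show "z \<in> P" unfolding y using face by blast
    qed
  qed
  moreover have "J' \<subseteq> I" by (auto simp: J'_def)
  then have "?F \<in> C" using g AJ unfolding chart_at_def by blast
  moreover have "?F \<subseteq> Q" unfolding Qg cube_face_def using A(1) by (auto simp: J'_def)
  ultimately show "\<exists>F\<in>C. F \<subseteq> Q \<and> P = coords c v w ` F" by blast
qed

lemma interval_embeds:
  assumes V: "v \<in> \<Union>C" "w \<in> \<Union>C" and dim: "complex_dim (interval C v w) n"
  shows "\<exists>L. lattice_subcomplex n L \<and> cc_isomorphic (interval C v w) L"
proof -
  \<comment> \<open>The cube from \<open>antichain_cube\<close> lies in the interval, so its
    \<open>2 ^ card A\<close> vertices number at most \<open>2 ^ n\<close>.\<close>
  have "card A \<le> n" if A: "A \<subseteq> separators v w" "antichain A" for A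
  proof -
    obtain Q where Q: "Q \<in> C" "Q \<subseteq> between v w" "card Q = 2 ^ card A"
      using antichain_cube[OF V A] by blast
    then have "card Q \<le> 2 ^ n" using dim unfolding complex_dim_def interval_eq[OF V] by blast
    then show ?thesis using Q(3) by simp
  qed
  then obtain c where c: "chain_cover c (separators v w) n" using dilworth[OF finite_separators[OF V]] by blast
  let ?K = "interval C v w" and ?f = "coords c v w"
  let ?L = "(`) ?f ` ?K"
  have K: "?K = {Q \<in> C. Q \<subseteq> between v w}" by (rule interval_eq[OF V])
  have inj: "inj_on ?f (\<Union>?K)" by (rule inj_on_subset[OF coords_inj[OF V c]]) (auto simp: K)
  have "lattice_subcomplex n ?L"
    unfolding lattice_subcomplex_def
  proof (intro conjI ballI allI impI)
    fix R assume "R \<in> ?L"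
    then obtain Q where Q: "Q \<in> C" "Q \<subseteq> between v w" "R = ?f ` Q" by (auto simp: K)
    show "lattice_cube n R" using coords_cube_image(1)[OF V c Q(1,2)] Q(3) by simp
    fix P assume "lattice_cube n P \<and> P \<subseteq> R"
    then obtain F where "F \<in> C" "F \<subseteq> Q" "P = ?f ` F" using coords_cube_image(2)[OF V c Q(1,2)] Q(3) by blast
    then show "P \<in> ?L" using Q(2) by (auto simp: K)
  qed
  moreover have "cc_isomorphic ?K ?L"
    unfolding cc_isomorphic_def
  proof (intro exI[of _ ?f] conjI allI impI)
    show "bij_betw ?f (\<Union>?K) (\<Union>?L)" using inj by (auto simp: bij_betw_def)
    fix Q assume Q: "Q \<subseteq> \<Union>?K"
    show "Q \<in> ?K \<longleftrightarrow> ?f ` Q \<in> ?L"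
    proof
      assume "?f ` Q \<in> ?L"
      then obtain R where R: "R \<in> ?K" "?f ` Q = ?f ` R" by blast
      then have "Q = R" using inj_on_image_eq_iff[OF inj Q, of R] by blast
      then show "Q \<in> ?K" using R(1) by simp
    qed (rule imageI)
  qed
  ultimately show ?thesis by blast
qed

end

theorem theorem3p5:
  fixes X :: "'v set set" and v w :: 'v and n :: nat
  assumes "CAT0_cube_complex X"
    and "v \<in> \<Union>X" and "w \<in> \<Union>X"
    and "complex_dim (interval X v w) n"
  shows "\<exists>L. lattice_subcomplex n L \<and> cc_isomorphic (interval X v w) L"
proof -
  interpret cat0_cube X by unfold_locales (rule assms(1))
  show ?thesis using assms(2-4) by (rule interval_embeds)
qed

end
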